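(* Let $q$ be a prime with $q\equiv 1\pmod 3$, and write $4q=L^2+27M^2$ with $L,M\in\mathbb{Z}$ and $L\equiv 1\pmod 3$. Let $p$ be a prime with $p\neq 2,3,q$ and $p\nmid LM$. Then \[ \sum_{k=(p+1)/2}^{\lfloor 2p/3\rfloor}\binom{3k}{k}\frac{M^{2k}}{q^k}\equiv \begin{cases} 0 \pmod{p}, & \text{if } p^{\frac{q-1}{3}}\equiv 1\pmod{q};\\[3pt] \pm\frac{3M}{L} \pmod{p}, & \text{if } p^{\frac{q-1}{3}}\equiv \frac{-1\pm 9M/L}{2}\pmod{q}, \end{cases} \] and \[ \sum_{k=(p+1)/2}^{\lfloor 2p/3\rfloor}\binom{3k}{k}\frac{L^{2k}}{(27q)^k}\equiv \begin{cases} 0 \pmod{p}, & \text{if } p^{\frac{q-1}{3}}\equiv 1\pmod{q};\\[3pt] \pm\frac{L}{9M} \pmod{p}, & \text{if } p^{\frac{q-1}{3}}\equiv \frac{-1\pm L/(3M)}{2}\pmod{q}. \end{cases} \]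
   Context: Congruences between rationals whose denominators are prime to the modulus are in the usual sense. In each case the signs $\pm$ correspond. *)

theory Defs
  imports Complex_Main "HOL-Computational_Algebra.Primes" "HOL-Number_Theory.Cong"
begin

(* Congruence in the ring of rationals whose reduced denominator is prime to m.  Both sides are
   required to lie in that ring. *)
definition rat_cong :: "rat \<Rightarrow> rat \<Rightarrow> int \<Rightarrow> bool" where
  "rat_cong a b m \<longleftrightarrow>
     coprime (snd (quotient_of a)) m \<and> coprime (snd (quotient_of b)) m \<and>
     m dvd fst (quotient_of (a - b))"

end

theory Submission
  imports Defs "Jordan_Normal_Form.Char_Poly" "HOL-Number_Theory.Residues"
begin

text \<open>
  Put \<open>x = M\<^sup>2 / q\<close> (or \<open>x = L\<^sup>2 / (27 q)\<close>) and \<open>y = 1 / x\<close>. For \<open>p / 2 < k < 2 p / 3\<close> one has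
  \<open>(3 k choose k) \<equiv> - ((p - 1 - k) choose (2 k - p))\<close> modulo \<open>p\<close>, which turns the sum into \<open>- h (p - 2)\<close>
  for the sequence with \<open>h (n + 3) = y (h (n + 1) + h n)\<close>, \<open>h 0 = 1\<close>, \<open>h 1 = 0\<close>, \<open>h 2 = y\<close>. In terms of the roots
  \<open>a, b, c\<close> of \<open>t\<^sup>3 = y t + y\<close> this is
  \<open>((b - c) a\<^sup>p + (c - a) b\<^sup>p + (a - b) c\<^sup>p) / ((a - b) (b - c) (c - a))\<close>, so only the action of the Frobenius
  on the roots matters.

  Let \<open>\<chi>\<close> be the cubic character modulo \<open>q\<close> with \<open>\<chi> z = \<omega>\<^sup>j\<close> for
  \<open>z\<^bsup>(q - 1) / 3\<^esup> \<equiv> ((- 1 + 9 M / L) / 2)\<^sup>j\<close>, with Gauss sum \<open>G\<close> and Jacobi sum \<open>J\<close>. Then \<open>G\<^sup>3 = q J\<close>, and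
  \<open>J = (L + 3 M \<surd>-3) / 2\<close>. Hence the roots are \<open>(\<zeta> G' - \<zeta>' G) / (\<surd>-3 M)\<close>, respectively
  \<open>3 (\<zeta> G' + \<zeta>' G) / L\<close>, where \<open>\<zeta>\<^sup>3 = 1\<close> and the prime denotes conjugation. The Frobenius at \<open>p\<close> multiplies
  \<open>\<zeta>\<close> by \<open>\<chi> p\<close>.
\<close>

section \<open>Congruences in subrings\<close>

locale subring_set =
  fixes R :: "'a::comm_ring_1 set"
  assumes one_mem: "1 \<in> R"
    and diff_mem: "a \<in> R \<Longrightarrow> b \<in> R \<Longrightarrow> a - b \<in> R"
    and mult_mem: "a \<in> R \<Longrightarrow> b \<in> R \<Longrightarrow> a * b \<in> R"
begin

lemma zero_mem: "0 \<in> R"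
  using diff_mem[OF one_mem one_mem] by simp

lemma uminus_mem: "a \<in> R \<Longrightarrow> - a \<in> R"
  using diff_mem[OF zero_mem, of a] by simp

lemma add_mem: "a \<in> R \<Longrightarrow> b \<in> R \<Longrightarrow> a + b \<in> R"
  using diff_mem[OF _ uminus_mem, of a b] by simp

lemma power_mem: "a \<in> R \<Longrightarrow> a ^ n \<in> R"
  by (induction n) (auto intro: one_mem mult_mem)

lemma sum_mem: "(\<And>i. i \<in> I \<Longrightarrow> f i \<in> R) \<Longrightarrow> sum f I \<in> R"
  by (induction I rule: infinite_finite_induct) (auto intro: zero_mem add_mem)

lemma of_nat_mem: "of_nat n \<in> R"
  by (induction n) (auto intro: zero_mem one_mem add_mem)

lemma of_int_mem: "of_int n \<in> R"
  by (cases n rule: int_cases2) (auto intro: of_nat_mem uminus_mem)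

lemma numeral_mem: "numeral n \<in> R"
  using of_nat_mem[of "numeral n"] by simp

lemmas mem_intros = one_mem zero_mem diff_mem mult_mem uminus_mem add_mem power_mem sum_mem
  of_nat_mem of_int_mem numeral_mem

text \<open>Divisibility in the ambient type would be trivial over the complex numbers, so the
  quotient must lie in \<open>R\<close>.\<close>

definition pcong :: "nat \<Rightarrow> 'a \<Rightarrow> 'a \<Rightarrow> bool" where
  "pcong p a b \<longleftrightarrow> (\<exists>c\<in>R. a - b = of_nat p * c)"

lemma pcong_refl: "pcong p a a"
  unfolding pcong_def using zero_mem by force

lemma pcong_sym: "pcong p a b \<Longrightarrow> pcong p b a"
  unfolding pcong_def using uminus_mem by (metis minus_diff_eq mult_minus_right)

lemma pcong_trans [trans]: "pcong p a b \<Longrightarrow> pcong p b c \<Longrightarrow> pcong p a c"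
  unfolding pcong_def
  by (metis add_mem diff_add_cancel diff_add_eq distrib_left add_diff_eq)

lemma pcong_add: "pcong p a b \<Longrightarrow> pcong p c d \<Longrightarrow> pcong p (a + c) (b + d)"
  unfolding pcong_def by (metis add_mem add_diff_add distrib_left)

lemma pcong_mult_left: "pcong p a b \<Longrightarrow> c \<in> R \<Longrightarrow> pcong p (c * a) (c * b)"
  unfolding pcong_def by (metis mult_mem mult.left_commute right_diff_distrib)

lemma pcong_mult:
  assumes "pcong p a b" "pcong p c d" "b \<in> R" "c \<in> R"
  shows "pcong p (a * c) (b * d)"
proof -
  have "pcong p (c * a) (c * b)" using assms by (intro pcong_mult_left)
  moreover have "pcong p (b * c) (b * d)" using assms by (intro pcong_mult_left)
  ultimately show ?thesis by (metis pcong_trans mult.commute)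
qed

lemma pcong_sum: "(\<And>i. i \<in> I \<Longrightarrow> pcong p (f i) (g i)) \<Longrightarrow> pcong p (sum f I) (sum g I)"
  by (induction I rule: infinite_finite_induct) (auto intro: pcong_refl pcong_add)

lemma pcong_of_int: "[a = b] (mod int p) \<Longrightarrow> pcong p (of_int a) (of_int b)"
  unfolding pcong_def cong_iff_dvd_diff dvd_def
  by (metis of_int_diff of_int_mult of_int_of_nat_eq of_int_mem)

lemma pcong_add_power:
  assumes p: "prime p" and a: "a \<in> R" and b: "b \<in> R"
  shows "pcong p ((a + b) ^ p) (a ^ p + b ^ p)"
proof -
  have p0: "p > 0" using p by (simp add: prime_gt_0_nat)
  define h where "h k = of_nat (p choose k) * a ^ k * b ^ (p - k)" for k
  have "(a + b) ^ p = (\<Sum>k\<le>p. h k)"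
    unfolding h_def by (rule binomial_ring)
  also have "{..p} = insert 0 (insert p {0<..<p})" using p0 by auto
  also have "sum h \<dots> = a ^ p + b ^ p + sum h {0<..<p}"
    using p0 by (simp add: h_def add_ac)
  finally have *: "(a + b) ^ p - (a ^ p + b ^ p) = sum h {0<..<p}" by simp
  have "pcong p (h k) 0" if k: "k \<in> {0<..<p}" for k
  proof -
    have "p dvd (p choose k)"
      using k p by (intro dvd_choose_prime) auto
    then obtain m where "p choose k = p * m" by auto
    then have "h k = of_nat p * (of_nat m * a ^ k * b ^ (p - k))"
      by (simp add: h_def mult_ac)
    then show ?thesis unfolding pcong_def using a b by (force intro!: mem_intros)
  qed
  then have "pcong p (sum h {0<..<p}) (\<Sum>k\<in>{0<..<p}. 0)" by (intro pcong_sum)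
  then show ?thesis using * unfolding pcong_def by simp
qed

text \<open>Additivity of the Frobenius modulo \<open>p\<close>; applied to the resolvents at
  \<open>p\<close> and to the Gauss sum at 3.\<close>

lemma pcong_sum_power:
  assumes p: "prime p" and f: "\<And>i. i \<in> I \<Longrightarrow> f i \<in> R"
  shows "pcong p (sum f I ^ p) (\<Sum>i\<in>I. f i ^ p)"
  using f
proof (induction I rule: infinite_finite_induct)
  case (insert x I)
  have "pcong p ((f x + sum f I) ^ p) (f x ^ p + sum f I ^ p)"
    using insert by (intro pcong_add_power p sum_mem) auto
  also have "pcong p \<dots> (f x ^ p + (\<Sum>i\<in>I. f i ^ p))"
    using insert by (intro pcong_add pcong_refl) auto
  finally show ?case using insert by simp
qed (use p in \<open>auto simp: power_0_left prime_gt_0_nat intro: pcong_refl\<close>)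

end

text \<open>Fermat's little theorem by induction: additivity of the Frobenius in the integers yields
  \<open>(1 + n) ^ p\<close> from \<open>n ^ p\<close>.\<close>

lemma int_power_prime_cong:
  fixes a :: int
  assumes "prime p"
  shows "[a ^ p = a] (mod int p)"
proof -
  interpret subring_set "UNIV :: int set" by unfold_locales auto
  have nat: "[int n ^ p = int n] (mod int p)" for n
  proof (induction n)
    case (Suc n)
    have "pcong p ((1 + int n) ^ p) (1 ^ p + int n ^ p)"
      using assms by (intro pcong_add_power) auto
    then have "[(1 + int n) ^ p = 1 + int n ^ p] (mod int p)"
      by (auto simp: pcong_def cong_iff_dvd_diff)
    also have "[1 + int n ^ p = 1 + int n] (mod int p)"
      using Suc by (intro cong_add cong_refl)
    finally show ?case by (simp add: add.commute)
  qed (use assms in \<open>auto simp: power_0_left prime_gt_0_nat\<close>)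
  have p0: "int p > 0" using assms by (simp add: prime_gt_0_nat)
  define r where "r = nat (a mod int p)"
  have r: "[a = int r] (mod int p)" using p0 by (simp add: r_def cong_def)
  have "[a ^ p = int r ^ p] (mod int p)" using r by (rule cong_pow)
  also note nat
  also have "[int r = a] (mod int p)" using r by (rule cong_sym)
  finally show ?thesis .
qed

text \<open>The characteristic polynomial of an integer matrix is monic with integer coefficients,
  and \<open>c\<close> is one of its roots.\<close>

lemma algebraic_int_eigenvalue_int:
  fixes A :: "int mat" and c :: complex
  assumes A: "A \<in> carrier_mat n n" and v: "v \<in> carrier_vec n" "v \<noteq> 0\<^sub>v n"
    and ev: "map_mat of_int A *\<^sub>v v = c \<cdot>\<^sub>v v"
  shows "algebraic_int c"
proof -
  let ?A = "map_mat of_int A :: complex mat"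
  have A': "?A \<in> carrier_mat n n" using A by auto
  have "eigenvalue ?A c"
    unfolding eigenvalue_def eigenvector_def using v ev A by auto
  then have "poly (char_poly ?A) c = 0"
    using eigenvalue_root_char_poly[OF A'] by simp
  moreover have "char_poly ?A = map_poly of_int (char_poly A)"
    by (rule of_int_hom.char_poly_hom[OF A])
  moreover have "lead_coeff (char_poly A) = 1"
    using degree_monic_char_poly[OF A] by simp
  ultimately show ?thesis unfolding algebraic_int_altdef_ipoly by metis
qed

section \<open>Cyclotomic integers\<close>

definition unity_root :: "nat \<Rightarrow> int \<Rightarrow> complex" where
  "unity_root n k = cis (2 * pi * of_int k / of_nat n)"

lemma unity_root_add: "unity_root n (a + b) = unity_root n a * unity_root n b"
  by (simp add: unity_root_def cis_mult distrib_left add_divide_distrib)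

lemma unity_root_0 [simp]: "unity_root n 0 = 1"
  by (simp add: unity_root_def)

lemma cnj_unity_root: "cnj (unity_root n k) = unity_root n (- k)"
  by (simp add: unity_root_def cis_cnj)

lemma unity_root_power: "unity_root n k ^ m = unity_root n (int m * k)"
  by (simp add: unity_root_def DeMoivre mult_ac)

lemma unity_root_eq_1_iff:
  assumes "n > 0"
  shows "unity_root n k = 1 \<longleftrightarrow> int n dvd k"
proof -
  have "unity_root n k = 1 \<longleftrightarrow> (\<exists>j::int. 2 * pi * of_int k / of_nat n = of_int j * 2 * pi)"
    unfolding unity_root_def complex_eq_iff
    by (simp, metis cos_one_2pi_int cos_one_sin_zero)
  also have "\<dots> \<longleftrightarrow> (\<exists>j::int. real_of_int k = of_int (int n * j))"
    using assms by (intro ex_cong1) (simp add: field_simps)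
  also have "\<dots> \<longleftrightarrow> int n dvd k"
    by (simp only: of_int_eq_iff dvd_def)
  finally show ?thesis .
qed

lemma unity_root_cong:
  assumes "n > 0" "[a = b] (mod int n)"
  shows "unity_root n a = unity_root n b"
proof -
  have "unity_root n a = unity_root n b * unity_root n (a - b)"
    by (simp flip: unity_root_add)
  also have "unity_root n (a - b) = 1"
    using assms by (simp add: unity_root_eq_1_iff cong_iff_dvd_diff)
  finally show ?thesis by simp
qed

text \<open>The ring generated by a primitive \<open>n\<close>-th root of unity, spanned by all
  \<open>n\<close> powers instead of a basis: closure under products only takes a reduction of
  exponents, at the price of coefficients that are in general not unique.\<close>

definition cyclotomic_ring :: "nat \<Rightarrow> complex set" where
  "cyclotomic_ring n = range (\<lambda>f. \<Sum>k<n. of_int (f k) * unity_root n (int k))"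

lemma cyclotomic_ring_diff:
  "a \<in> cyclotomic_ring n \<Longrightarrow> b \<in> cyclotomic_ring n \<Longrightarrow> a - b \<in> cyclotomic_ring n"
proof -
  assume "a \<in> cyclotomic_ring n" "b \<in> cyclotomic_ring n"
  then obtain f g where "a = (\<Sum>k<n. of_int (f k) * unity_root n (int k))"
    "b = (\<Sum>k<n. of_int (g k) * unity_root n (int k))" by (auto simp: cyclotomic_ring_def)
  then have "a - b = (\<Sum>k<n. of_int (f k - g k) * unity_root n (int k))"
    by (simp add: sum_subtractf algebra_simps)
  then show ?thesis unfolding cyclotomic_ring_def by (rule range_eqI[where x = "\<lambda>k. f k - g k"])
qed

lemma of_int_mult_unity_root_mem:
  assumes "n > 0"
  shows "of_int c * unity_root n k \<in> cyclotomic_ring n"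
proof -
  define r where "r = nat (k mod int n)"
  have r: "r < n" using assms by (simp add: r_def nat_less_iff)
  have k: "unity_root n k = unity_root n (int r)"
    using assms by (intro unity_root_cong) (auto simp: r_def cong_def)
  have "of_int c * unity_root n k = (\<Sum>j<n. if j = r then of_int c * unity_root n (int j) else 0)"
    using r k by simp
  also have "\<dots> = (\<Sum>j<n. of_int (if j = r then c else 0) * unity_root n (int j))"
    by (intro sum.cong) auto
  finally show ?thesis unfolding cyclotomic_ring_def by (rule range_eqI[where x = "\<lambda>j. if j = r then c else 0"])
qed

lemma subring_cyclotomic_ring:
  assumes n: "n > 0"
  shows "subring_set (cyclotomic_ring n)"
proof
  show "1 \<in> cyclotomic_ring n"
    using of_int_mult_unity_root_mem[OF n, of 1 0] by simp
next
  fix a b assume ab: "a \<in> cyclotomic_ring n" "b \<in> cyclotomic_ring n"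
  show "a - b \<in> cyclotomic_ring n" using ab by (rule cyclotomic_ring_diff)
  have zero: "0 \<in> cyclotomic_ring n" using cyclotomic_ring_diff[OF ab(1) ab(1)] by simp
  have add: "x + y \<in> cyclotomic_ring n" if "x \<in> cyclotomic_ring n" "y \<in> cyclotomic_ring n" for x y
    using cyclotomic_ring_diff[OF that(1) cyclotomic_ring_diff[OF zero that(2)]] by simp
  have sum: "sum h I \<in> cyclotomic_ring n" if "\<And>i. i \<in> I \<Longrightarrow> h i \<in> cyclotomic_ring n"
    for h and I :: "nat set"
    using that by (induction I rule: infinite_finite_induct) (auto intro: zero add)
  obtain f g where "a = (\<Sum>k<n. of_int (f k) * unity_root n (int k))"
    "b = (\<Sum>k<n. of_int (g k) * unity_root n (int k))"
    using ab by (auto simp: cyclotomic_ring_def)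
  then have "a * b = (\<Sum>k<n. \<Sum>j<n. of_int (f k * g j) * unity_root n (int k + int j))"
    by (simp add: sum_product unity_root_add mult_ac)
  also have "\<dots> \<in> cyclotomic_ring n"
    by (intro sum of_int_mult_unity_root_mem n)
  finally show "a * b \<in> cyclotomic_ring n" .
qed

lemma cnj_cyclotomic_ring:
  assumes "n > 0" "a \<in> cyclotomic_ring n"
  shows "cnj a \<in> cyclotomic_ring n"
proof -
  interpret subring_set "cyclotomic_ring n" using assms(1) by (rule subring_cyclotomic_ring)
  obtain f where "a = (\<Sum>k<n. of_int (f k) * unity_root n (int k))"
    using assms by (auto simp: cyclotomic_ring_def)
  then have "cnj a = (\<Sum>k<n. of_int (f k) * unity_root n (- int k))"
    by (simp add: cnj_unity_root)
  also have "\<dots> \<in> cyclotomic_ring n"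
    by (intro sum_mem of_int_mult_unity_root_mem assms)
  finally show ?thesis .
qed

text \<open>Multiplication by \<open>c\<close> acts on the vector of all powers of the root of unity
  through an integer matrix \<open>A\<close>, so this vector is an eigenvector of \<open>A\<close>
  with eigenvalue \<open>c\<close>.\<close>

lemma algebraic_int_cyclotomic_ring:
  assumes n: "n > 0" and c: "c \<in> cyclotomic_ring n"
  shows "algebraic_int c"
proof -
  interpret subring_set "cyclotomic_ring n" using n by (rule subring_cyclotomic_ring)
  have "\<forall>i. \<exists>f. c * unity_root n (int i) = (\<Sum>k<n. of_int (f k) * unity_root n (int k))"
  proof
    fix i
    have "c * (of_int 1 * unity_root n (int i)) \<in> cyclotomic_ring n"
      by (intro mult_mem c of_int_mult_unity_root_mem n)
    then show "\<exists>f. c * unity_root n (int i) = (\<Sum>k<n. of_int (f k) * unity_root n (int k))"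
      by (auto simp: cyclotomic_ring_def)
  qed
  then obtain F where F: "\<And>i. c * unity_root n (int i) = (\<Sum>k<n. of_int (F i k) * unity_root n (int k))"
    by metis
  define A where "A = mat n n (\<lambda>(i, k). F i k)"
  define v where "v = vec n (\<lambda>i. unity_root n (int i))"
  show ?thesis
  proof (rule algebraic_int_eigenvalue_int)
    show "A \<in> carrier_mat n n" by (simp add: A_def)
    show "v \<in> carrier_vec n" by (simp add: v_def)
    have "v $ 0 \<noteq> 0\<^sub>v n $ 0" using n by (simp add: v_def)
    then show "v \<noteq> 0\<^sub>v n" by auto
    show "map_mat of_int A *\<^sub>v v = c \<cdot>\<^sub>v v"
    proof (rule eq_vecI)
      fix i assume "i < dim_vec (c \<cdot>\<^sub>v v)"
      then have i: "i < n" by (simp add: v_def)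
      then have "(map_mat of_int A *\<^sub>v v) $ i = (\<Sum>k = 0..<n. of_int (F i k) * unity_root n (int k))"
        by (simp add: A_def v_def scalar_prod_def)
      also have "\<dots> = (c \<cdot>\<^sub>v v) $ i" using i by (simp add: F v_def atLeast0LessThan)
      finally show "(map_mat of_int A *\<^sub>v v) $ i = (c \<cdot>\<^sub>v v) $ i" .
    qed (simp add: A_def v_def)
  qed
qed

section \<open>Rational elements and localisation at \<open>p\<close>\<close>

lemma rational_cyclotomic_ring:
  assumes "n > 0" "c \<in> cyclotomic_ring n" "c \<in> \<rat>"
  shows "c \<in> \<int>"
  using assms algebraic_int_cyclotomic_ring rational_algebraic_int_is_int by blast

text \<open>The localisation of the cyclotomic ring at the integers prime to \<open>p\<close>. The
  roots of the cubic have denominators such as \<open>M\<close> or \<open>L\<close>, so their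
  congruences modulo \<open>p\<close> live here.\<close>

definition local_cyclotomic_ring :: "nat \<Rightarrow> nat \<Rightarrow> complex set" where
  "local_cyclotomic_ring p n =
     {c. \<exists>d::int. \<not> int p dvd d \<and> of_int d * c \<in> cyclotomic_ring n}"

lemma cyclotomic_ring_subset_local:
  assumes "prime p"
  shows "cyclotomic_ring n \<subseteq> local_cyclotomic_ring p n"
proof
  fix c assume "c \<in> cyclotomic_ring n"
  moreover have "\<not> int p dvd 1" using assms by auto
  ultimately show "c \<in> local_cyclotomic_ring p n"
    unfolding local_cyclotomic_ring_def by (auto intro!: exI[of _ 1])
qed

lemma subring_local_cyclotomic_ring:
  assumes n: "n > 0" and p: "prime p"
  shows "subring_set (local_cyclotomic_ring p n)"
proof -
  interpret A: subring_set "cyclotomic_ring n" using n by (rule subring_cyclotomic_ring)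
  have dvd: "\<not> int p dvd d * e" if "\<not> int p dvd d" "\<not> int p dvd e" for d e
    using that p by (simp add: prime_dvd_mult_iff)
  show ?thesis
  proof
    show "1 \<in> local_cyclotomic_ring p n"
      using cyclotomic_ring_subset_local[OF p] A.one_mem by blast
  next
    fix a b assume "a \<in> local_cyclotomic_ring p n" "b \<in> local_cyclotomic_ring p n"
    then obtain d e where d: "\<not> int p dvd d" "of_int d * a \<in> cyclotomic_ring n"
      and e: "\<not> int p dvd e" "of_int e * b \<in> cyclotomic_ring n"
      unfolding local_cyclotomic_ring_def by blast
    have "of_int (d * e) * (a - b) = of_int e * (of_int d * a) - of_int d * (of_int e * b)"
      by (simp add: algebra_simps)
    also have "\<dots> \<in> cyclotomic_ring n" by (rule A.diff_mem[OF A.mult_mem[OF A.of_int_mem d(2)] A.mult_mem[OF A.of_int_mem e(2)]])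
    finally show "a - b \<in> local_cyclotomic_ring p n"
      unfolding local_cyclotomic_ring_def using dvd[OF d(1) e(1)] by blast
    have "of_int (d * e) * (a * b) = (of_int d * a) * (of_int e * b)"
      by (simp add: algebra_simps)
    also have "\<dots> \<in> cyclotomic_ring n" by (rule A.mult_mem[OF d(2) e(2)])
    finally show "a * b \<in> local_cyclotomic_ring p n"
      unfolding local_cyclotomic_ring_def using dvd[OF d(1) e(1)] by blast
  qed
qed

lemma inverse_of_int_local_mem:
  assumes n: "n > 0" and p: "prime p" and d: "\<not> int p dvd d"
  shows "inverse (of_int d) \<in> local_cyclotomic_ring p n"
proof -
  interpret A: subring_set "cyclotomic_ring n" using n by (rule subring_cyclotomic_ring)
  have "d \<noteq> 0" using d by auto
  then have "of_int d * inverse (of_int d :: complex) = 1" by simp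
  then show ?thesis
    unfolding local_cyclotomic_ring_def using d A.one_mem by auto
qed

text \<open>If \<open>d\<close> prime to \<open>p\<close> clears the denominator, then
  \<open>d * r\<close> is a rational algebraic integer, hence an integer, and the reduced
  denominator of \<open>r\<close> divides \<open>d\<close>.\<close>

lemma rational_local_mem_denom:
  assumes n: "n > 0" and p: "prime p" and r: "of_rat r \<in> local_cyclotomic_ring p n"
  shows "coprime (snd (quotient_of r)) (int p)"
proof -
  obtain d :: int where d: "\<not> int p dvd d" and dr: "of_int d * of_rat r \<in> cyclotomic_ring n"
    using r unfolding local_cyclotomic_ring_def by blast
  obtain u v where uv: "quotient_of r = (u, v)" by force
  have v: "v > 0" and cop: "coprime u v" and r_eq: "r = of_int u / of_int v"
    using quotient_of_denom_pos[OF uv] quotient_of_coprime[OF uv] quotient_of_div[OF uv] by auto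
  have "(of_int d * of_rat r :: complex) = of_rat (of_int d * r)" by (simp add: of_rat_mult)
  then have "of_int d * of_rat r \<in> (\<int> :: complex set)"
    using dr by (intro rational_cyclotomic_ring[OF n]) (auto simp: Rats_def)
  then obtain k where "(of_int d * of_rat r :: complex) = of_int k" by (auto elim: Ints_cases)
  then have "(of_rat (of_int d * r) :: complex) = of_rat (of_int k)" by (simp add: of_rat_mult)
  then have "of_int d * r = of_int k" by (simp only: of_rat_eq_iff)
  then have "(of_int (d * u) :: rat) = of_int (k * v)" using v by (simp add: r_eq field_simps)
  then have "d * u = k * v" by (simp only: of_int_eq_iff)
  then have "v dvd d"
    using cop by (metis coprime_commute coprime_dvd_mult_left_iff dvd_triv_right)
  then have "\<not> int p dvd v" using d by auto
  then have "coprime (int p) v" using p by (intro prime_imp_coprime) auto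
  then show ?thesis by (simp add: uv coprime_commute)
qed

text \<open>The way back from complex numbers to rationals: \<open>(a - b) / p\<close> is itself a
  rational in the local ring, so its denominator is prime to \<open>p\<close>.\<close>

lemma rat_cong_local:
  assumes n: "n > 0" and p: "prime p"
    and a: "of_rat a \<in> local_cyclotomic_ring p n" and b: "of_rat b \<in> local_cyclotomic_ring p n"
    and ab: "subring_set.pcong (local_cyclotomic_ring p n) p (of_rat a) (of_rat b)"
  shows "rat_cong a b (int p)"
proof -
  interpret B: subring_set "local_cyclotomic_ring p n"
    using n p by (rule subring_local_cyclotomic_ring)
  have p0: "p > 0" using p by (simp add: prime_gt_0_nat)
  obtain c where c: "c \<in> local_cyclotomic_ring p n" "of_rat a - of_rat b = of_nat p * c"
    using ab unfolding B.pcong_def by blast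
  define r where "r = (a - b) / of_nat p"
  have r: "of_rat r = c" using c(2) p0 by (simp add: r_def of_rat_divide of_rat_diff field_simps)
  obtain u v where uv: "quotient_of r = (u, v)" by force
  have v: "v > 0" and r_eq: "r = of_int u / of_int v"
    using quotient_of_denom_pos[OF uv] quotient_of_div[OF uv] by auto
  have cop: "coprime v (int p)"
    using rational_local_mem_denom[OF n p, of r] c(1) r uv by simp
  obtain s t where st: "quotient_of (a - b) = (s, t)" by force
  have t: "t > 0" and ab_eq: "a - b = of_int s / of_int t"
    using quotient_of_denom_pos[OF st] quotient_of_div[OF st] by auto
  have "a - b = of_nat p * r" using p0 by (simp add: r_def)
  then have "(of_int (s * v) :: rat) = of_int (int p * u * t)"
    using v t unfolding ab_eq r_eq by (simp add: field_simps)
  then have "s * v = int p * u * t" by (simp only: of_int_eq_iff)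
  then have "int p dvd s * v" by simp
  then have "int p dvd s" using cop by (simp add: coprime_commute coprime_dvd_mult_left_iff)
  then show ?thesis
    unfolding rat_cong_def using rational_local_mem_denom[OF n p] a b st by simp
qed

text \<open>The numerator of \<open>a - b\<close> in lowest terms divides every integer of the form
  \<open>(a - b) * v\<close>. This clears denominators in the hypotheses modulo
  \<open>q\<close>.\<close>

lemma rat_cong_imp_dvd:
  assumes "rat_cong a b m" "(a - b) * of_int v = of_int u"
  shows "m dvd u"
proof -
  obtain s t where st: "quotient_of (a - b) = (s, t)" by force
  have t: "t > 0" and ab_eq: "a - b = of_int s / of_int t" and cop: "coprime s t"
    using quotient_of_denom_pos[OF st] quotient_of_div[OF st] quotient_of_coprime[OF st] by auto
  have "(of_int (s * v) :: rat) = of_int (u * t)"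
    using t assms(2) unfolding ab_eq by (simp add: field_simps)
  then have "s * v = u * t" by (simp only: of_int_eq_iff)
  then have "s dvd u * t" by (metis dvd_triv_left)
  then have "s dvd u" using cop by (simp add: coprime_dvd_mult_left_iff)
  moreover have "m dvd s" using assms(1) st by (simp add: rat_cong_def)
  ultimately show ?thesis by (rule dvd_trans[rotated])
qed

section \<open>Reduction of the binomial sum to a cubic recurrence\<close>

text \<open>A case of Lucas's theorem: in the Vandermonde expansion every term but
  \<open>i = 0\<close> contains some \<open>p choose i\<close> with
  \<open>0 < i < p\<close>.\<close>

lemma choose_add_prime_cong:
  assumes p: "prime p" and k: "k < p"
  shows "[(p + r) choose k = r choose k] (mod p)"
proof -
  have "{..k} = insert 0 {1..k}" by auto
  then have "(p + r) choose k = (r choose k) + (\<Sum>i\<in>{1..k}. (p choose i) * (r choose (k - i)))"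
    by (simp flip: vandermonde)
  moreover have "p dvd (\<Sum>i\<in>{1..k}. (p choose i) * (r choose (k - i)))"
  proof (intro dvd_sum dvd_mult2)
    fix i assume "i \<in> {1..k}"
    then show "p dvd (p choose i)" using k p by (intro dvd_choose_prime) auto
  qed
  ultimately show ?thesis by (auto simp: cong_def)
qed

lemma fact_mult_choose_int: "fact j * int (r choose j) = (\<Prod>i<j. int r - int i)"
proof -
  have "real_of_int (fact j * int (r choose j)) = fact j * (real r gchoose j)"
    by (simp add: binomial_gbinomial)
  also have "\<dots> = real_of_int (\<Prod>i<j. int r - int i)"
    by (simp add: gbinomial_mult_fact atLeast0LessThan)
  finally show ?thesis by (simp only: of_int_eq_iff)
qed

text \<open>Writing \<open>3 k = p + r\<close> leaves \<open>r choose k = r choose j\<close>, whose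
  falling factorial is compared with that of \<open>n choose j\<close>; \<open>fact j\<close>
  cancels since \<open>j < p\<close>.\<close>

lemma choose_3k_k_cong:
  assumes p: "prime p" and odd: "odd p" and k1: "p < 2 * k" and k2: "3 * k < 2 * p"
  shows "[int ((3 * k) choose k) = - int ((p - 1 - k) choose (2 * k - p))] (mod int p)"
proof -
  define r where "r = 3 * k - p"
  define j where "j = 2 * k - p"
  define n where "n = p - 1 - k"
  have jr: "j \<le> r" "r - j = k" "j < p" and kp: "k < p"
    and ints: "int r = 3 * int k - int p" "int j = 2 * int k - int p" "int n = int p - 1 - int k"
    using k1 k2 by (auto simp: r_def j_def n_def)
  have oddj: "odd j" using odd k1 by (simp add: j_def)
  have "[(p + r) choose k = r choose k] (mod p)"
    using p kp by (rule choose_add_prime_cong)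
  moreover have "p + r = 3 * k" using k1 by (simp add: r_def)
  moreover have "r choose k = r choose j" using jr by (metis binomial_symmetric)
  ultimately have 1: "[int ((3 * k) choose k) = int (r choose j)] (mod int p)"
    by (simp add: cong_int_iff)
  have "fact j * int (r choose j) = (\<Prod>i<j. int r - int i)"
    by (rule fact_mult_choose_int)
  \<comment> \<open>Read upwards the factors are \<open>k + 1 + i\<close>, and
    \<open>(k + 1 + i) + (n - i) = p\<close>.\<close>
  also have "\<dots> = (\<Prod>i<j. int r - int (j - Suc i))"
    by (rule prod.nat_diff_reindex [symmetric])
  also have "[\<dots> = (\<Prod>i<j. (-1) * (int n - int i))] (mod int p)"
  proof (rule cong_prod)
    fix i assume "i \<in> {..<j}"
    then have "int r - int (j - Suc i) - (-1) * (int n - int i) = int p"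
      using ints by (simp add: of_nat_diff)
    then show "[int r - int (j - Suc i) = (-1) * (int n - int i)] (mod int p)"
      by (simp only: cong_iff_dvd_diff dvd_refl)
  qed
  \<comment> \<open>The sign survives because \<open>j = 2 k - p\<close> is odd.\<close>
  also have "(\<Prod>i<j. (-1) * (int n - int i)) = - (\<Prod>i<j. int n - int i)"
    using oddj by (subst prod.distrib) simp
  also have "\<dots> = fact j * (- int (n choose j))"
    by (simp flip: fact_mult_choose_int)
  finally have "[fact j * int (r choose j) = fact j * (- int (n choose j))] (mod int p)" .
  moreover have "coprime (fact j :: int) (int p)"
  proof -
    have "coprime p (fact j)"
      using p jr by (intro prime_imp_coprime) (auto simp: prime_dvd_fact_iff)
    then have "coprime (int (fact j)) (int p)" by (simp only: coprime_int_iff coprime_commute)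
    then show ?thesis by simp
  qed
  ultimately have "[int (r choose j) = - int (n choose j)] (mod int p)"
    by (subst (asm) cong_mult_lcancel)
  then show ?thesis using 1 cong_trans unfolding j_def n_def by blast
qed

text \<open>The closed form of the recurrence \<open>h (n + 3) = y (h (n + 1) + h n)\<close> obtained from
  \<open>1 / (1 - y t\<^sup>2 (1 + t))\<close>.\<close>
definition cubic_seq :: "'a::comm_ring_1 \<Rightarrow> nat \<Rightarrow> 'a" where
  "cubic_seq y m = (\<Sum>n | 2 * n \<le> m. of_nat (n choose (m - 2 * n)) * y ^ n)"

text \<open>Pascal's rule, applied to the binomial coefficients of the summands.\<close>

lemma cubic_seq_rec: "cubic_seq y (m + 3) = y * (cubic_seq y (m + 1) + cubic_seq y m)"
proof -
  \<comment> \<open>Extension by zero puts the sums for \<open>m\<close>, \<open>m + 1\<close> and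
    \<open>m + 3\<close> on a common index range.\<close>
  define F where "F k n = (if 2 * n \<le> k then of_nat (n choose (k - 2 * n)) * y ^ n else 0)" for k n
  have seq: "cubic_seq y k = sum (F k) {..N}" if "k \<le> N" for k N
  proof -
    have fin: "finite {n. 2 * n \<le> k}" by (rule finite_subset[of _ "{..k}"]) auto
    have "cubic_seq y k = sum (F k) {n. 2 * n \<le> k}"
      unfolding cubic_seq_def F_def by (intro sum.cong) auto
    also have "\<dots> = sum (F k) {..N}"
      using that by (intro sum.mono_neutral_left) (auto simp: F_def)
    finally show ?thesis .
  qed
  have step: "F (m + 3) (Suc n) = y * (F (m + 1) n + F m n)" for n
  proof (cases "2 * n \<le> m")
    case True
    then have "m + 3 - 2 * Suc n = Suc (m - 2 * n)" "m + 1 - 2 * n = Suc (m - 2 * n)" by auto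
    then show ?thesis using True by (simp add: F_def algebra_simps)
  next
    case False
    then show ?thesis by (cases "2 * n = m + 1") (auto simp: F_def)
  qed
  have "cubic_seq y (m + 3) = sum (F (m + 3)) {..Suc (m + 2)}" by (rule seq) simp
  also have "\<dots> = F (m + 3) 0 + (\<Sum>n\<le>m + 2. F (m + 3) (Suc n))" by (rule sum.atMost_Suc_shift)
  also have "F (m + 3) 0 = 0" by (simp add: F_def binomial_eq_0)
  also have "(\<Sum>n\<le>m + 2. F (m + 3) (Suc n)) = y * (sum (F (m + 1)) {..m + 2} + sum (F m) {..m + 2})"
    unfolding step by (simp add: sum_distrib_left sum.distrib distrib_left)
  also have "sum (F (m + 1)) {..m + 2} = cubic_seq y (m + 1)" by (rule seq [symmetric]) simp
  also have "sum (F m) {..m + 2} = cubic_seq y m" by (rule seq [symmetric]) simp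
  finally show ?thesis by simp
qed

lemma cubic_seq_0: "cubic_seq y 0 = 1"
proof -
  have "{n::nat. n = 0} = {0}" by auto
  then show ?thesis by (simp add: cubic_seq_def)
qed

lemma cubic_seq_1: "cubic_seq y 1 = 0"
proof -
  have "{n::nat. 2 * n \<le> 1} = {0}" by auto
  then show ?thesis by (simp add: cubic_seq_def)
qed

lemma cubic_seq_2: "cubic_seq y 2 = y"
proof -
  have "{n::nat. 2 * n \<le> 2} = {0, 1}" by auto
  then show ?thesis by (simp add: cubic_seq_def binomial_eq_0)
qed

text \<open>Under these relations \<open>cubic_seq y m\<close> is the complete homogeneous symmetric
  polynomial of degree \<open>m\<close> in the roots. This is its quotient-of-alternants formula,
  multiplied out to hold in any commutative ring. Both sides obey the recurrence, so the indices 0,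
  1, 2 suffice.\<close>

lemma cubic_seq_roots:
  fixes a b c y :: "'a::comm_ring_1"
  assumes e1: "a + b + c = 0" and e2: "a * b + b * c + c * a = - y" and e3: "a * b * c = y"
  shows "cubic_seq y m * ((a - b) * (b - c) * (c - a)) =
    (c - b) * a ^ (m + 2) + (a - c) * b ^ (m + 2) + (b - a) * c ^ (m + 2)"
proof -
  have root: "z ^ 3 = y * (z + 1)"
    if "z + u + v = 0" "z * u + u * v + v * z = - y" "z * u * v = y" for z u v
  proof -
    have "u + v = - z" using that(1) by (simp add: eq_neg_iff_add_eq_0 add_ac)
    then have "z ^ 3 = - (z * z * (u + v))" by (simp add: power3_eq_cube)
    also have "\<dots> = - (z * u + u * v + v * z) * z + z * u * v" by (simp add: algebra_simps)
    also have "\<dots> = y * (z + 1)" unfolding that by (simp add: algebra_simps)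
    finally show ?thesis .
  qed
  have a3: "a ^ 3 = y * (a + 1)" and b3: "b ^ 3 = y * (b + 1)" and c3: "c ^ 3 = y * (c + 1)"
    using root[of a b c] root[of b c a] root[of c a b] e1 e2 e3 by (simp_all add: ac_simps)
  show ?thesis
  proof (induction m rule: less_induct)
    case (less m)
    consider "m = 0" | "m = 1" | "m = 2" | k where "m = k + 3"
      by (metis One_nat_def add.commute add_Suc_right numeral_2_eq_2 numeral_3_eq_3 not0_implies_Suc plus_nat.add_0)
    then show ?case
    proof cases
      case 1
      then show ?thesis by (simp add: cubic_seq_0 algebra_simps power2_eq_square)
    next
      case 2
      have "(c - b) * a ^ 3 + (a - c) * b ^ 3 + (b - a) * c ^ 3 = 0"
        unfolding a3 b3 c3 by (simp add: algebra_simps)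
      then show ?thesis using 2 cubic_seq_1[of y] by (simp add: eval_nat_numeral)
    next
      case 3
      have "(c - b) * a ^ 4 + (a - c) * b ^ 4 + (b - a) * c ^ 4 =
          (c - b) * (a ^ 3 * a) + (a - c) * (b ^ 3 * b) + (b - a) * (c ^ 3 * c)"
        by (simp add: eval_nat_numeral mult_ac)
      also have "\<dots> = y * ((a - b) * (b - c) * (c - a))"
        unfolding a3 b3 c3 by (simp add: algebra_simps)
      finally have "y * ((a - b) * (b - c) * (c - a)) =
          (c - b) * a ^ 4 + (a - c) * b ^ 4 + (b - a) * c ^ 4" ..
      then show ?thesis using 3 cubic_seq_2[of y] by simp
    next
      case 4
      let ?D = "(a - b) * (b - c) * (c - a)"
      have pow: "z ^ (m + 2) = y * (z ^ (k + 1 + 2) + z ^ (k + 2))" if "z ^ 3 = y * (z + 1)" for z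
      proof -
        have "m + 2 = 3 + (k + 2)" using 4 by simp
        then have "z ^ (m + 2) = z ^ 3 * z ^ (k + 2)" by (simp only: power_add)
        then show ?thesis by (simp add: that algebra_simps)
      qed
      have "cubic_seq y m * ?D = y * (cubic_seq y (k + 1) * ?D + cubic_seq y k * ?D)"
        unfolding 4 cubic_seq_rec by (simp only: algebra_simps)
      also have "\<dots> = (c - b) * a ^ (m + 2) + (a - c) * b ^ (m + 2) + (b - a) * c ^ (m + 2)"
      proof -
        have lt: "k < m" "k + 1 < m" using 4 by auto
        show ?thesis
          unfolding less.IH[OF lt(1)] less.IH[OF lt(2)] pow[OF a3] pow[OF b3] pow[OF c3]
          by (simp only: algebra_simps)
      qed
      finally show ?thesis .
    qed
  qed
qed

text \<open>Put \<open>n = p - 1 - k\<close>. Then \<open>x ^ k\<close> is congruent to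
  \<open>y ^ n\<close>, because \<open>x\<close> and \<open>y\<close> are inverse and
  \<open>x ^ (p - 1)\<close> is congruent to 1, while \<open>2 k - p = p - 2 - 2 n\<close>.\<close>

lemma (in subring_set) sum_choose_3k_k_pcong:
  assumes p: "prime p" "p > 3" and x: "x \<in> R" "y \<in> R" "x * y = 1" "pcong p (x ^ (p - 1)) 1"
  shows "pcong p (\<Sum>k = (p + 1) div 2..(2 * p) div 3. of_nat ((3 * k) choose k) * x ^ k)
    (- cubic_seq y (p - 2))"
proof -
  have odd: "odd p" using p by (simp add: prime_odd_nat)
  have ndvd: "\<not> 3 dvd p"
    using p by (metis prime_nat_iff less_irrefl numeral_eq_one_iff semiring_norm(86))
  let ?I = "{(p + 1) div 2..(2 * p) div 3}"
  have "pcong p (\<Sum>k\<in>?I. of_nat ((3 * k) choose k) * x ^ k)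
      (\<Sum>k\<in>?I. - of_nat ((p - 1 - k) choose (2 * k - p)) * y ^ (p - 1 - k))"
  proof (intro pcong_sum pcong_mult x power_mem uminus_mem of_nat_mem)
    fix k assume "k \<in> ?I"
    then have k: "p < 2 * k" "3 * k \<le> 2 * p" using odd by (auto elim!: oddE)
    \<comment> \<open>The strict bound in \<open>choose_3k_k_cong\<close> requires that
      \<open>3 k = 2 p\<close> be excluded.\<close>
    moreover have "3 * k \<noteq> 2 * p"
    proof
      assume "3 * k = 2 * p"
      then have "3 dvd 2 * p" by (metis dvd_triv_left)
      then show False using ndvd by presburger
    qed
    ultimately have k': "3 * k < 2 * p" by simp
    have "pcong p (of_int (int ((3 * k) choose k))) (of_int (- int ((p - 1 - k) choose (2 * k - p))))"
      using p odd k k' by (intro pcong_of_int choose_3k_k_cong)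
    then show "pcong p (of_nat ((3 * k) choose k)) (- of_nat ((p - 1 - k) choose (2 * k - p)))" by simp
    have kp: "k \<le> p - 1" using k k' by auto
    have "p - 1 = k + (p - 1 - k)" using kp by simp
    then have "x ^ (p - 1) = x ^ k * x ^ (p - 1 - k)" by (metis power_add)
    then have "x ^ (p - 1) * y ^ (p - 1 - k) = x ^ k * (x * y) ^ (p - 1 - k)"
      by (simp only: power_mult_distrib mult.assoc)
    then have "x ^ k = y ^ (p - 1 - k) * x ^ (p - 1)" using x by (simp add: mult.commute)
    moreover have "pcong p (y ^ (p - 1 - k) * x ^ (p - 1)) (y ^ (p - 1 - k) * 1)"
      using x by (intro pcong_mult_left power_mem)
    ultimately show "pcong p (x ^ k) (y ^ (p - 1 - k))" by simp
  qed
  also have "(\<Sum>k\<in>?I. - of_nat ((p - 1 - k) choose (2 * k - p)) * y ^ (p - 1 - k)) =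
     - (\<Sum>k\<in>?I. of_nat ((p - 1 - k) choose (2 * k - p)) * y ^ (p - 1 - k))"
    by (simp add: sum_negf)
  also have "(\<Sum>k\<in>?I. of_nat ((p - 1 - k) choose (2 * k - p)) * y ^ (p - 1 - k)) =
      (\<Sum>n | 2 * n \<le> p - 2 \<and> p - 2 \<le> 3 * n. of_nat (n choose (p - 2 - 2 * n)) * y ^ n)"
    (is "_ = sum ?h _")
  proof (rule sum.reindex_bij_witness[of _ "\<lambda>n. p - 1 - n" "\<lambda>k. p - 1 - k"])
    fix k assume k: "k \<in> ?I"
    then have k: "p < 2 * k" "3 * k \<le> 2 * p" using odd by (auto elim!: oddE)
    moreover have "3 * k \<noteq> 2 * p"
    proof
      assume "3 * k = 2 * p"
      then have "3 dvd 2 * p" by (metis dvd_triv_left)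
      then show False using ndvd by presburger
    qed
    ultimately show "p - 1 - (p - 1 - k) = k"
      "p - 1 - k \<in> {n. 2 * n \<le> p - 2 \<and> p - 2 \<le> 3 * n}" by auto
    have "p - 2 - 2 * (p - 1 - k) = 2 * k - p" using k \<open>3 * k \<noteq> 2 * p\<close> by auto
    then show "of_nat ((p - 1 - k) choose (p - 2 - 2 * (p - 1 - k))) * y ^ (p - 1 - k) =
      of_nat ((p - 1 - k) choose (2 * k - p)) * y ^ (p - 1 - k)" by simp
  next
    fix n assume n: "n \<in> {n. 2 * n \<le> p - 2 \<and> p - 2 \<le> 3 * n}"
    then show "p - 1 - (p - 1 - n) = n" by auto
    obtain b where b: "p = 2 * b + 1" using odd by (rule oddE)
    have "n < b" using n p b by auto
    then have "p + 1 \<le> 2 * (p - 1 - n)" "3 * (p - 1 - n) \<le> 2 * p"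
      using n p b by auto
    then show "p - 1 - n \<in> ?I" by auto
  qed
  also have "\<dots> = cubic_seq y (p - 2)"
    unfolding cubic_seq_def
  \<comment> \<open>Indices with \<open>3 n < p - 2\<close> can be added: there the lower entry of
    the binomial coefficient exceeds the upper one.\<close>
  proof (rule sum.mono_neutral_left)
    show "finite {n. 2 * n \<le> p - 2}" by (rule finite_subset[of _ "{..p}"]) auto
    show "\<forall>n\<in>{n. 2 * n \<le> p - 2} - {n. 2 * n \<le> p - 2 \<and> p - 2 \<le> 3 * n}. ?h n = 0"
    proof
      fix n assume "n \<in> {n. 2 * n \<le> p - 2} - {n. 2 * n \<le> p - 2 \<and> p - 2 \<le> 3 * n}"
      then have "n < p - 2 - 2 * n" by auto
      then have "n choose (p - 2 - 2 * n) = 0" by (rule binomial_eq_0)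
      then show "?h n = 0" by (simp only: of_nat_0 mult_zero_left)
    qed
  qed auto
  finally show ?thesis .
qed

text \<open>The term of index \<open>p - 2\<close> involves exactly the \<open>p\<close>-th powers
  of the roots, so the Frobenius images decide the sum; \<open>d\<close> inverts the product of root
  differences.\<close>

lemma (in subring_set) sum_choose_3k_k_pcong_roots:
  assumes p: "prime p" "p > 3" and x: "x \<in> R" "y \<in> R" "x * y = 1" "pcong p (x ^ (p - 1)) 1"
    and abc: "a \<in> R" "b \<in> R" "c \<in> R"
    and e1: "a + b + c = 0" and e2: "a * b + b * c + c * a = - y" and e3: "a * b * c = y"
    and d: "d \<in> R" "(a - b) * (b - c) * (c - a) * d = 1"
    and frob: "pcong p (a ^ p) a'" "pcong p (b ^ p) b'" "pcong p (c ^ p) c'"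
  shows "pcong p (\<Sum>k = (p + 1) div 2..(2 * p) div 3. of_nat ((3 * k) choose k) * x ^ k)
    (d * ((b - c) * a' + (c - a) * b' + (a - b) * c'))"
proof -
  have "cubic_seq y (p - 2) = cubic_seq y (p - 2) * ((a - b) * (b - c) * (c - a)) * d"
    using d by (simp add: mult.assoc)
  also have "\<dots> = ((c - b) * a ^ (p - 2 + 2) + (a - c) * b ^ (p - 2 + 2) + (b - a) * c ^ (p - 2 + 2)) * d"
    by (simp only: cubic_seq_roots[OF e1 e2 e3])
  also have "p - 2 + 2 = p" using p by simp
  finally have "- cubic_seq y (p - 2) = d * ((b - c) * a ^ p + (c - a) * b ^ p + (a - b) * c ^ p)"
    by (simp add: algebra_simps)
  also have "pcong p \<dots> (d * ((b - c) * a' + (c - a) * b' + (a - b) * c'))"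
    using abc d frob by (intro pcong_mult_left pcong_add diff_mem)
  finally show ?thesis
    using sum_choose_3k_k_pcong[OF p x] pcong_trans by blast
qed

section \<open>Cubic Gauss and Jacobi sums\<close>

text \<open>A map that is injective modulo \<open>q\<close> permutes the residue classes; used for
  translations and for multiplication by units.\<close>

lemma sum_residues_reindex:
  fixes f :: "int \<Rightarrow> 'a::comm_monoid_add"
  assumes q: "q > 0" and f: "\<And>x. f (x mod q) = f x"
    and h: "\<And>x y. [h x = h y] (mod q) \<Longrightarrow> [x = y] (mod q)"
  shows "(\<Sum>x\<in>{0..<q}. f (h x)) = (\<Sum>x\<in>{0..<q}. f x)"
proof -
  have inj: "inj_on (\<lambda>x. h x mod q) {0..<q}"
  proof (rule inj_onI)
    fix x y assume xy: "x \<in> {0..<q}" "y \<in> {0..<q}" "h x mod q = h y mod q"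
    then have "[h x = h y] (mod q)" by (simp add: cong_def)
    then have "[x = y] (mod q)" by (rule h)
    then show "x = y" using xy by (simp add: cong_def)
  qed
  moreover have "(\<lambda>x. h x mod q) ` {0..<q} = {0..<q}"
    using inj q by (intro endo_inj_surj) auto
  ultimately have "(\<Sum>x\<in>{0..<q}. f x) = (\<Sum>x\<in>{0..<q}. f (h x mod q))"
    using sum.reindex[OF inj, of f] by (simp add: o_def)
  then show ?thesis by (simp add: f)
qed

text \<open>The polynomial \<open>x ^ j - 1\<close> has at most \<open>j\<close> roots modulo
  \<open>q\<close>, fewer than the \<open>q - 1\<close> nonzero classes.\<close>

lemma exists_power_not_cong_1:
  assumes q: "prime q" and j: "0 < j" "j < q - 1"
  shows "\<exists>g::int. \<not> int q dvd g \<and> \<not> [g ^ j = 1] (mod int q)"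
proof (rule ccontr)
  assume contra: "\<not> (\<exists>g::int. \<not> int q dvd g \<and> \<not> [g ^ j = 1] (mod int q))"
  let ?A = "{x \<in> {..<q}. [x ^ j = 1] (mod q)}"
  have "{1..<q} \<subseteq> ?A"
  proof
    fix x assume x: "x \<in> {1..<q}"
    then have "\<not> q dvd x" by (auto dest: dvd_imp_le)
    then have "[int x ^ j = 1] (mod int q)" using contra int_dvd_int_iff by blast
    then have "[x ^ j = 1] (mod q)" by (metis cong_int_iff of_nat_1 of_nat_power)
    then show "x \<in> ?A" using x by simp
  qed
  then have "q - 1 \<le> card ?A" using card_mono[of ?A "{1..<q}"] by simp
  also have "card ?A \<le> j" using q j by (intro roots_mod_prime_bound) auto
  finally show False using j by simp
qed

text \<open>Multiplying the variable by a suitable \<open>g\<close> preserves the sum modulo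
  \<open>q\<close> but also multiplies it by \<open>g ^ j\<close>, which is not 1.\<close>

lemma prime_dvd_power_sum:
  assumes q: "prime q" and j: "0 < j" "j < q - 1"
  shows "int q dvd (\<Sum>x\<in>{0..<int q}. x ^ j)"
proof -
  obtain g where g: "\<not> int q dvd g" "\<not> [g ^ j = 1] (mod int q)"
    using exists_power_not_cong_1[OF assms] by blast
  have cop: "coprime g (int q)"
    using g(1) q by (metis coprime_commute prime_imp_coprime prime_nat_int_transfer)
  let ?S = "\<Sum>x\<in>{0..<int q}. x ^ j"
  have "[g ^ j * ?S = (\<Sum>x\<in>{0..<int q}. (g * x) ^ j mod int q)] (mod int q)"
    unfolding sum_distrib_left power_mult_distrib by (intro cong_sum) (simp add: cong_def)
  also have "(\<Sum>x\<in>{0..<int q}. (g * x) ^ j mod int q) = (\<Sum>x\<in>{0..<int q}. x ^ j mod int q)"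
    using q cop by (intro sum_residues_reindex)
      (auto simp: power_mod cong_mult_lcancel prime_gt_0_nat)
  also have "[\<dots> = ?S] (mod int q)" by (intro cong_sum) (simp add: cong_def)
  finally have "int q dvd (g ^ j - 1) * ?S" by (simp add: cong_iff_dvd_diff algebra_simps)
  moreover have "\<not> int q dvd g ^ j - 1" using g(2) by (simp add: cong_iff_dvd_diff)
  ultimately show ?thesis using q by (simp add: prime_dvd_mult_iff)
qed

lemma unity_root_mult_left: "k > 0 \<Longrightarrow> unity_root n a = unity_root (k * n) (int k * a)"
  by (simp add: unity_root_def mult_ac)

text \<open>Translation by 1 multiplies the sum by \<open>unity_root q a\<close>, which is not
  1.\<close>

lemma sum_unity_root:
  assumes q: "q > 0" and a: "\<not> int q dvd a"
  shows "(\<Sum>x\<in>{0..<int q}. unity_root q (a * x)) = 0"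
proof -
  let ?S = "\<Sum>x\<in>{0..<int q}. unity_root q (a * x)"
  have "(\<Sum>x\<in>{0..<int q}. unity_root q (a * (x + 1))) = ?S"
  proof (rule sum_residues_reindex)
    show "unity_root q (a * (x mod int q)) = unity_root q (a * x)" for x
      using q by (intro unity_root_cong) (auto simp: cong_def mod_mult_right_eq)
    show "[x + 1 = y + 1] (mod int q) \<Longrightarrow> [x = y] (mod int q)" for x y
      by (simp only: cong_add_rcancel)
  qed (use q in simp)
  also have "(\<Sum>x\<in>{0..<int q}. unity_root q (a * (x + 1))) = unity_root q a * ?S"
    by (simp add: sum_distrib_left distrib_left unity_root_add mult.commute)
  finally have "(unity_root q a - 1) * ?S = 0" by (simp add: algebra_simps)
  moreover have "unity_root q a \<noteq> 1" using assms by (simp add: unity_root_eq_1_iff)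
  ultimately show ?thesis by simp
qed

section \<open>Complex cube roots of unity and the cubic character\<close>

abbreviation cube_root_unity :: complex ("\<omega>") where
  "\<omega> \<equiv> unity_root 3 1"

lemma omega_cube: "\<omega> ^ 3 = 1"
  by (simp add: unity_root_power unity_root_eq_1_iff)

lemma omega_quadratic: "\<omega>\<^sup>2 = - \<omega> - 1"
proof -
  have "\<omega> \<noteq> 1" by (simp add: unity_root_eq_1_iff)
  moreover have "(\<omega> - 1) * (\<omega>\<^sup>2 + \<omega> + 1) = 0"
    using omega_cube by (simp add: algebra_simps power2_eq_square power3_eq_cube)
  ultimately have "\<omega>\<^sup>2 + \<omega> + 1 = 0" by simp
  then have "\<omega>\<^sup>2 = - (\<omega> + 1)" by (simp only: eq_neg_iff_add_eq_0 add.assoc)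
  then show ?thesis by simp
qed

lemma cnj_omega: "cnj \<omega> = - \<omega> - 1"
proof -
  have "cnj \<omega> = \<omega>\<^sup>2"
    unfolding cnj_unity_root unity_root_power by (intro unity_root_cong) (auto simp: cong_def)
  then show ?thesis by (simp add: omega_quadratic)
qed

text \<open>The cube root of unity \<open>w\<close> modulo \<open>q\<close> singles out one of the
  two conjugate cubic characters. In the application it is \<open>(9 M - L) / (2 L)\<close> modulo
  \<open>q\<close>.\<close>

locale cubic_character =
  fixes q m :: nat and w :: int
  assumes prime_q: "prime q" and q_eq: "q = 3 * m + 1"
    and w: "[w\<^sup>2 + w + 1 = 0] (mod int q)"
begin

lemma q_pos: "q > 0" "int q > 0" and m_pos: "m > 0"
  using q_eq prime_gt_1_nat[OF prime_q] by auto

lemma prime_int_q: "prime (int q)"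
  using prime_q by simp

lemma not_dvd_1: "\<not> int q dvd 1"
  using prime_int_q by (metis not_prime_unit)

text \<open>This makes the character even, see \<open>chi_minus\<close>.\<close>

lemma even_m: "even m"
proof (rule ccontr)
  assume "odd m"
  then have "even q" using q_eq by simp
  then have "q = 2" using prime_q by (metis primes_dvd_imp_eq two_is_prime_nat)
  then show False using q_eq by presburger
qed

lemma w_cube: "[w ^ 3 = 1] (mod int q)"
proof -
  have "w ^ 3 - 1 = (w - 1) * (w\<^sup>2 + w + 1)" by (simp add: algebra_simps eval_nat_numeral)
  then show ?thesis using w by (simp add: cong_iff_dvd_diff)
qed

lemma w_not_1: "\<not> [w = 1] (mod int q)"
proof
  assume "[w = 1] (mod int q)"
  then have "int q dvd w - 1" by (simp add: cong_iff_dvd_diff)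
  moreover have "int q dvd w\<^sup>2 + w + 1" using w by (simp add: cong_iff_dvd_diff)
  ultimately have "int q dvd (w\<^sup>2 + w + 1) - (w - 1) * (w + 2)" by (metis dvd_diff dvd_mult2)
  moreover have "(w\<^sup>2 + w + 1) - (w - 1) * (w + 2) = 3" by (simp add: algebra_simps power2_eq_square)
  ultimately have "q dvd 3" by (metis int_dvd_int_iff of_nat_numeral)
  then have "q \<le> 3" by (rule dvd_imp_le) simp
  then show False using q_eq m_pos by simp
qed

lemma w_not_dvd: "\<not> int q dvd w"
proof
  assume "int q dvd w"
  then have "int q dvd w ^ 3" by (simp add: eval_nat_numeral)
  then show False using w_cube not_dvd_1 by (metis cong_dvd_iff)
qed

lemma w_power_mod_3: "[w ^ j = w ^ (j mod 3)] (mod int q)"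
proof -
  have "w ^ j = (w ^ 3) ^ (j div 3) * w ^ (j mod 3)" by (simp flip: power_mult power_add)
  also have "[\<dots> = 1 ^ (j div 3) * w ^ (j mod 3)] (mod int q)"
    by (intro cong_mult cong_pow w_cube cong_refl)
  finally show ?thesis by simp
qed

text \<open>By Fermat \<open>x ^ m\<close> is a root of \<open>z ^ 3 - 1\<close>, which splits
  modulo \<open>q\<close> into linear factors with roots 1, \<open>w\<close> and
  \<open>w ^ 2\<close>.\<close>

lemma power_m_cases:
  assumes x: "\<not> int q dvd x"
  obtains j where "[x ^ m = w ^ j] (mod int q)"
proof -
  have "[nat (x mod int q) ^ (q - 1) = 1] (mod q)"
  proof (rule fermat_theorem[OF prime_q])
    have "\<not> int q dvd x mod int q" using x by (simp add: dvd_mod_iff)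
    then show "\<not> q dvd nat (x mod int q)" using q_pos by (simp add: int_dvd_int_iff [symmetric])
  qed
  then have "[int (nat (x mod int q)) ^ (q - 1) = 1] (mod int q)"
    by (metis cong_int_iff of_nat_1 of_nat_power)
  then have "[x ^ (q - 1) = 1] (mod int q)" using q_pos by (simp add: cong_def power_mod)
  moreover have "x ^ (q - 1) = (x ^ m) ^ 3" by (simp add: q_eq mult.commute flip: power_mult)
  ultimately have 1: "int q dvd (x ^ m) ^ 3 - 1" by (simp add: cong_iff_dvd_diff)
  define z where "z = x ^ m"
  \<comment> \<open>An identity over the integers whose last two terms vanish modulo
    \<open>q\<close>.\<close>
  have "z ^ 3 - 1 = (z - 1) * (z - w) * (z - w\<^sup>2) + (w\<^sup>2 + w + 1) * (z\<^sup>2 - w * z) + (w ^ 3 - 1)"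
    by (simp add: algebra_simps eval_nat_numeral)
  moreover have "int q dvd w\<^sup>2 + w + 1" "int q dvd w ^ 3 - 1"
    using w w_cube by (auto simp: cong_iff_dvd_diff)
  ultimately have "int q dvd (z - 1) * (z - w) * (z - w\<^sup>2)"
    using 1 unfolding z_def [symmetric]
    by (metis (no_types, lifting) dvd_add_left_iff dvd_mult2)
  then have "int q dvd z - w ^ 0 \<or> int q dvd z - w ^ 1 \<or> int q dvd z - w ^ 2"
    using prime_int_q by (simp add: prime_dvd_mult_iff)
  then show ?thesis using that by (auto simp only: z_def cong_iff_dvd_diff)
qed

text \<open>For units the last branch means \<open>x ^ m\<close> congruent to \<open>w ^ 2\<close>,
  the only case left by \<open>power_m_cases\<close> and \<open>w_power_mod_3\<close>.\<close>

definition chi :: "int \<Rightarrow> complex" where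
  "chi x = (if int q dvd x then 0 else if [x ^ m = 1] (mod int q) then 1
     else if [x ^ m = w] (mod int q) then \<omega> else \<omega>\<^sup>2)"

text \<open>The powers 1, \<open>w\<close>, \<open>w ^ 2\<close> are distinct modulo
  \<open>q\<close>, so \<open>j\<close> is determined modulo 3, and that fixes the power of
  \<omega>.\<close>

lemma chi_eq:
  assumes x: "\<not> int q dvd x" and j: "[x ^ m = w ^ j] (mod int q)"
  shows "chi x = \<omega> ^ j"
proof -
  have w2: "\<not> [w\<^sup>2 = 1] (mod int q)" "\<not> [w\<^sup>2 = w] (mod int q)"
  proof -
    show "\<not> [w\<^sup>2 = 1] (mod int q)"
    proof
      assume "[w\<^sup>2 = 1] (mod int q)"
      then have "[w * w\<^sup>2 = w * 1] (mod int q)" by (intro cong_mult cong_refl)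
      moreover have "w * w\<^sup>2 = w ^ 3" by (simp add: eval_nat_numeral)
      ultimately show False using w_cube w_not_1 by (metis cong_sym cong_trans mult.right_neutral)
    qed
    show "\<not> [w\<^sup>2 = w] (mod int q)"
    proof
      assume "[w\<^sup>2 = w] (mod int q)"
      then have "int q dvd w * (w - 1)"
        by (simp add: cong_iff_dvd_diff algebra_simps power2_eq_square)
      then show False
        using w_not_1 w_not_dvd prime_int_q by (auto simp: prime_dvd_mult_iff cong_iff_dvd_diff)
    qed
  qed
  have "[x ^ m = w ^ (j mod 3)] (mod int q)" using j w_power_mod_3 by (rule cong_trans)
  moreover have "j mod 3 = 0 \<or> j mod 3 = 1 \<or> j mod 3 = 2" by auto
  ultimately have "chi x = \<omega> ^ (j mod 3)"
    using x w2 w_not_1 by (auto simp: chi_def cong_def)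
  also have "\<dots> = \<omega> ^ j"
  proof -
    have "\<omega> ^ j = (\<omega> ^ 3) ^ (j div 3) * \<omega> ^ (j mod 3)" by (simp flip: power_mult power_add)
    then show ?thesis by (simp add: omega_cube)
  qed
  finally show ?thesis .
qed

lemma chi_0: "int q dvd x \<Longrightarrow> chi x = 0"
  by (simp add: chi_def)

lemma chi_mod: "chi (x mod int q) = chi x"
  by (simp add: chi_def dvd_mod_iff cong_def power_mod)

lemma chi_cong: "[x = y] (mod int q) \<Longrightarrow> chi x = chi y"
  by (metis chi_mod cong_def)

lemma chi_cases:
  assumes "\<not> int q dvd x"
  obtains j where "[x ^ m = w ^ j] (mod int q)" "chi x = \<omega> ^ j"
  using assms chi_eq power_m_cases by metis

lemma chi_mult: "chi (x * y) = chi x * chi y"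
proof (cases "int q dvd x \<or> int q dvd y")
  case True
  then show ?thesis by (auto simp: chi_0)
next
  case False
  obtain i where i: "[x ^ m = w ^ i] (mod int q)" "chi x = \<omega> ^ i"
    using False chi_cases by blast
  obtain j where j: "[y ^ m = w ^ j] (mod int q)" "chi y = \<omega> ^ j"
    using False chi_cases by blast
  have "[x ^ m * y ^ m = w ^ i * w ^ j] (mod int q)" using i j by (intro cong_mult)
  then have "[(x * y) ^ m = w ^ (i + j)] (mod int q)" by (simp add: power_mult_distrib power_add)
  moreover have "\<not> int q dvd x * y" using False prime_int_q by (simp add: prime_dvd_mult_iff)
  ultimately have "chi (x * y) = \<omega> ^ (i + j)" by (intro chi_eq)
  then show ?thesis using i j by (simp add: power_add)
qed

lemma chi_1: "chi 1 = 1"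
  using not_dvd_1 by (simp add: chi_def)

lemma chi_minus: "chi (- x) = chi x"
  using even_m by (simp add: chi_def)

lemma chi_cube: "\<not> int q dvd x \<Longrightarrow> chi x ^ 3 = 1"
  by (metis chi_cases omega_cube power_commutes power_mult power_one mult.commute)

lemma cnj_chi: "cnj (chi x) = chi x ^ 2"
proof (cases "int q dvd x")
  case False
  then obtain j where j: "chi x = \<omega> ^ j" using chi_cases by blast
  have "cnj \<omega> = \<omega>\<^sup>2" by (simp add: cnj_omega omega_quadratic)
  then show ?thesis by (simp add: j mult.commute flip: power_mult)
qed (simp add: chi_0)

lemma chi_cnj: "\<not> int q dvd x \<Longrightarrow> chi x * cnj (chi x) = 1"
  using chi_cube[of x] by (simp add: cnj_chi power2_eq_square power3_eq_cube mult.assoc)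

lemma chi_nontrivial: "\<exists>g. \<not> int q dvd g \<and> chi g \<noteq> 1"
proof -
  obtain g where g: "\<not> int q dvd g" "\<not> [g ^ m = 1] (mod int q)"
    using exists_power_not_cong_1[OF prime_q m_pos] q_eq m_pos by auto
  have "\<omega> \<noteq> 1" "\<omega>\<^sup>2 \<noteq> 1" by (auto simp: unity_root_power unity_root_eq_1_iff)
  then have "chi g \<noteq> 1" using g by (auto simp: chi_def)
  then show ?thesis using g by blast
qed

lemma coprime_iff: "coprime a (int q) \<longleftrightarrow> \<not> int q dvd a"
  using prime_int_q by (metis coprime_commute prime_imp_coprime coprime_absorb_left not_prime_unit)

lemma sum_residues_mult:
  fixes f :: "int \<Rightarrow> 'a::comm_monoid_add"
  assumes "\<And>x. f (x mod int q) = f x" "\<not> int q dvd a"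
  shows "(\<Sum>x\<in>{0..<int q}. f (a * x)) = (\<Sum>x\<in>{0..<int q}. f x)"
  using assms q_pos coprime_iff
  by (intro sum_residues_reindex) (auto simp: cong_mult_lcancel)

lemma sum_chi: "(\<Sum>x\<in>{0..<int q}. chi x) = 0"
proof -
  obtain g where g: "\<not> int q dvd g" "chi g \<noteq> 1" using chi_nontrivial by blast
  have "(\<Sum>x\<in>{0..<int q}. chi (g * x)) = (\<Sum>x\<in>{0..<int q}. chi x)"
    using g by (intro sum_residues_mult chi_mod)
  then have "chi g * (\<Sum>x\<in>{0..<int q}. chi x) = (\<Sum>x\<in>{0..<int q}. chi x)"
    by (simp add: chi_mult sum_distrib_left)
  then show ?thesis using g by simp
qed

section \<open>Gauss and Jacobi sums of the cubic character\<close>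

abbreviation e :: "int \<Rightarrow> complex" where "e \<equiv> unity_root q"

lemma e_mod: "e (x mod int q) = e x"
  using q_pos by (intro unity_root_cong) (auto simp: cong_def)

definition G :: complex where "G = (\<Sum>x\<in>{0..<int q}. chi x * e x)"

definition J :: complex where "J = (\<Sum>x\<in>{0..<int q}. chi x * chi (1 - x))"

text \<open>For a unit \<open>a\<close>, substitute \<open>a * x\<close> for \<open>x\<close> in
  \<open>G\<close>; otherwise both sides vanish since \<open>chi\<close> sums to zero.\<close>

lemma gauss_twist: "(\<Sum>x\<in>{0..<int q}. chi x * e (a * x)) = cnj (chi a) * G"
proof (cases "int q dvd a")
  case True
  then have "e (a * x) = 1" for x using q_pos by (simp add: unity_root_eq_1_iff)
  then show ?thesis using True by (simp add: sum_chi chi_0)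
next
  case False
  have "G = (\<Sum>x\<in>{0..<int q}. chi (a * x) * e (a * x))"
    unfolding G_def using False
    by (intro sum_residues_mult [symmetric]) (simp_all add: chi_mod e_mod)
  also have "\<dots> = chi a * (\<Sum>x\<in>{0..<int q}. chi x * e (a * x))"
    by (simp add: chi_mult sum_distrib_left mult.assoc)
  finally have "cnj (chi a) * G = (chi a * cnj (chi a)) * (\<Sum>x\<in>{0..<int q}. chi x * e (a * x))"
    by (simp add: mult_ac)
  then show ?thesis using chi_cnj[OF False] by simp
qed

lemma cnj_G: "cnj G = (\<Sum>x\<in>{0..<int q}. cnj (chi x) * e x)"
proof -
  have "cnj G = (\<Sum>x\<in>{0..<int q}. cnj (chi (- 1 * x)) * e (- 1 * x))"
    by (simp add: G_def cnj_unity_root chi_minus)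
  also have "\<dots> = (\<Sum>x\<in>{0..<int q}. cnj (chi x) * e x)"
    using not_dvd_1 by (intro sum_residues_mult) (simp_all add: chi_mod e_mod)
  finally show ?thesis .
qed

text \<open>Each \<open>cnj (chi y) * G\<close> unfolds into a twisted sum; summing over
  \<open>y\<close> first, orthogonality of additive characters leaves only
  \<open>x = 1\<close>.\<close>

lemma G_mult_cnj: "G * cnj G = of_nat q"
proof -
  have "G * cnj G = (\<Sum>y\<in>{0..<int q}. cnj (chi y) * G * e (- y))"
  proof -
    have "cnj G = (\<Sum>y\<in>{0..<int q}. cnj (chi y) * e (- y))"
      by (simp add: G_def cnj_unity_root)
    then show ?thesis by (simp add: sum_distrib_left mult_ac)
  qed
  also have "\<dots> = (\<Sum>y\<in>{0..<int q}. \<Sum>x\<in>{0..<int q}. chi x * e ((x - 1) * y))"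
  proof (intro sum.cong refl)
    fix y
    have "cnj (chi y) * G * e (- y) = (\<Sum>x\<in>{0..<int q}. chi x * (e (y * x) * e (- y)))"
      by (simp only: gauss_twist [symmetric] sum_distrib_right mult.assoc)
    also have "\<dots> = (\<Sum>x\<in>{0..<int q}. chi x * e ((x - 1) * y))"
      by (simp only: unity_root_add [symmetric]) (simp add: algebra_simps)
    finally show "cnj (chi y) * G * e (- y) = (\<Sum>x\<in>{0..<int q}. chi x * e ((x - 1) * y))" .
  qed
  also have "\<dots> = (\<Sum>x\<in>{0..<int q}. chi x * (\<Sum>y\<in>{0..<int q}. e ((x - 1) * y)))"
    by (subst sum.swap) (simp add: sum_distrib_left)
  also have "\<dots> = (\<Sum>x\<in>{0..<int q}. if x = 1 then of_nat q else 0)"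
  proof (intro sum.cong refl)
    fix x assume x: "x \<in> {0..<int q}"
    show "chi x * (\<Sum>y\<in>{0..<int q}. e ((x - 1) * y)) = (if x = 1 then of_nat q else 0)"
    proof (cases "x = 1")
      case False
      have "\<not> int q dvd x - 1"
      proof
        assume "int q dvd x - 1"
        then have "[x = 1] (mod int q)" by (simp add: cong_iff_dvd_diff)
        then show False using x False q_eq m_pos by (simp add: cong_def)
      qed
      then show ?thesis using False q_pos by (simp add: sum_unity_root)
    qed (simp add: chi_1)
  qed
  also have "\<dots> = of_nat q" using q_eq m_pos by simp
  finally show ?thesis .
qed

text \<open>Pairs \<open>(x, y)\<close> are grouped by their sum \<open>s\<close>. Scaling by
  \<open>s\<close> reduces the inner sum to \<open>J\<close> with factor \<open>chi s ^ 2\<close>;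
  if \<open>q\<close> divides \<open>s\<close>, it is a full sum of conjugate character values and
  vanishes.\<close>

lemma G_square: "G ^ 2 = J * cnj G"
proof -
  have inner: "(\<Sum>x\<in>{0..<int q}. chi x * chi (s - x)) = cnj (chi s) * J" for s
  proof (cases "int q dvd s")
    case True
    have "(\<Sum>x\<in>{0..<int q}. chi x * chi (s - x)) = (\<Sum>x\<in>{0..<int q}. cnj (chi x))"
    proof (intro sum.cong refl)
      fix x
      have "chi (s - x) = chi (- x)" using True by (intro chi_cong) (simp add: cong_iff_dvd_diff)
      then show "chi x * chi (s - x) = cnj (chi x)"
        by (simp add: chi_minus cnj_chi power2_eq_square)
    qed
    also have "\<dots> = cnj (\<Sum>x\<in>{0..<int q}. chi x)" by simp
    finally show ?thesis using True by (simp add: sum_chi chi_0)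
  next
    case False
    have "(\<Sum>x\<in>{0..<int q}. chi x * chi (s - x)) = (\<Sum>x\<in>{0..<int q}. chi (s * x) * chi (s - s * x))"
    proof (rule sum_residues_mult [symmetric])
      show "chi (x mod int q) * chi (s - x mod int q) = chi x * chi (s - x)" for x
        by (intro arg_cong2[of _ _ _ _ "(*)"] chi_cong) (auto simp: cong_def mod_diff_right_eq)
    qed (rule False)
    also have "\<dots> = (\<Sum>x\<in>{0..<int q}. chi (s * x) * chi (s * (1 - x)))"
      by (simp add: right_diff_distrib)
    also have "\<dots> = cnj (chi s) * J"
      by (simp add: chi_mult J_def cnj_chi power2_eq_square sum_distrib_left mult_ac)
    finally show ?thesis .
  qed
  have "G ^ 2 = (\<Sum>x\<in>{0..<int q}. \<Sum>y\<in>{0..<int q}. chi x * chi y * e (x + y))"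
    unfolding power2_eq_square G_def sum_product by (simp add: unity_root_add mult_ac)
  also have "\<dots> = (\<Sum>x\<in>{0..<int q}. \<Sum>s\<in>{0..<int q}. chi x * chi (s - x) * e s)"
  proof (rule sum.cong)
    fix x
    have "(\<Sum>s\<in>{0..<int q}. chi x * chi (s - x) * e s) =
      (\<Sum>y\<in>{0..<int q}. chi x * chi ((y + x) - x) * e (y + x))"
    proof (rule sum_residues_reindex [symmetric])
      show "chi x * chi (s mod int q - x) * e (s mod int q) = chi x * chi (s - x) * e s" for s
        by (simp add: e_mod, intro disjI2 chi_cong) (auto simp: cong_def mod_diff_left_eq)
      show "[y + x = z + x] (mod int q) \<Longrightarrow> [y = z] (mod int q)" for y z
        by (simp only: cong_add_rcancel)
    qed (rule q_pos)
    then show "(\<Sum>y\<in>{0..<int q}. chi x * chi y * e (x + y)) =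
      (\<Sum>s\<in>{0..<int q}. chi x * chi (s - x) * e s)" by (simp add: add.commute)
  qed simp
  also have "\<dots> = (\<Sum>s\<in>{0..<int q}. cnj (chi s) * J * e s)"
    by (subst sum.swap) (simp flip: sum_distrib_right inner)
  also have "\<dots> = J * cnj G" by (simp add: cnj_G sum_distrib_left mult_ac)
  finally show ?thesis .
qed

lemma G_cube: "G ^ 3 = of_nat q * J"
proof -
  have "G ^ 3 = G * G ^ 2" by (simp add: eval_nat_numeral)
  also have "\<dots> = (G * cnj G) * J" by (simp add: G_square)
  finally show ?thesis by (simp add: G_mult_cnj)
qed

text \<open>Multiplying \<open>G_square\<close> by its conjugate isolates \<open>J * cnj J\<close>,
  as \<open>G * cnj G\<close> is nonzero.\<close>

lemma J_mult_cnj: "J * cnj J = of_nat q"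
proof -
  have "(J * cnj J) * (G * cnj G) = (J * cnj G) * cnj (J * cnj G)" by simp
  also have "\<dots> = (G * cnj G) * (G * cnj G)" by (simp add: power2_eq_square flip: G_square)
  finally show ?thesis using q_pos by (simp add: G_mult_cnj)
qed

text \<open>Reduction from the Eisenstein integers to the integers modulo \<open>q\<close> with \<open>\<omega> \<mapsto> w\<close>, kept as a
  relation to avoid proving that it is well defined.\<close>
definition eis_rel :: "complex \<Rightarrow> int \<Rightarrow> bool" where
  "eis_rel z k \<longleftrightarrow> (\<exists>a b. z = of_int a + of_int b * \<omega> \<and> [k = a + b * w] (mod int q))"

lemma eis_rel_add: "eis_rel z k \<Longrightarrow> eis_rel z' k' \<Longrightarrow> eis_rel (z + z') (k + k')"
proof -
  assume "eis_rel z k" "eis_rel z' k'"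
  then obtain a b a' b' where
    *: "z = of_int a + of_int b * \<omega>" "[k = a + b * w] (mod int q)"
       "z' = of_int a' + of_int b' * \<omega>" "[k' = a' + b' * w] (mod int q)"
    unfolding eis_rel_def by blast
  have "z + z' = of_int (a + a') + of_int (b + b') * \<omega>" using * by (simp add: algebra_simps)
  moreover have "[k + k' = (a + a') + (b + b') * w] (mod int q)"
    using cong_add[OF *(2,4)] by (simp add: algebra_simps)
  ultimately show ?thesis unfolding eis_rel_def by blast
qed

lemma eis_rel_mult: "eis_rel z k \<Longrightarrow> eis_rel z' k' \<Longrightarrow> eis_rel (z * z') (k * k')"
proof -
  assume "eis_rel z k" "eis_rel z' k'"
  then obtain a b a' b' where
    *: "z = of_int a + of_int b * \<omega>" "[k = a + b * w] (mod int q)"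
       "z' = of_int a' + of_int b' * \<omega>" "[k' = a' + b' * w] (mod int q)"
    unfolding eis_rel_def by blast
  have "z * z' = of_int (a * a') + of_int (a * b' + b * a') * \<omega> + of_int (b * b') * \<omega>\<^sup>2"
    using * by (simp add: algebra_simps power2_eq_square)
  also have "\<dots> = of_int (a * a' - b * b') + of_int (a * b' + b * a' - b * b') * \<omega>"
    unfolding omega_quadratic by (simp add: algebra_simps)
  finally have 1: "z * z' = of_int (a * a' - b * b') + of_int (a * b' + b * a' - b * b') * \<omega>" .
  have "(a + b * w) * (a' + b' * w) =
      (a * a' - b * b' + (a * b' + b * a' - b * b') * w) + b * b' * (w\<^sup>2 + w + 1)"
    by (simp add: algebra_simps power2_eq_square)
  moreover have "[b * b' * (w\<^sup>2 + w + 1) = b * b' * 0] (mod int q)"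
    by (intro cong_mult cong_refl w)
  ultimately have "[(a + b * w) * (a' + b' * w) = (a * a' - b * b' + (a * b' + b * a' - b * b') * w) + 0]
      (mod int q)"
    by (simp only: cong_add_lcancel mult_zero_right)
  with cong_mult[OF *(2,4)] have "[k * k' = (a * a' - b * b') + (a * b' + b * a' - b * b') * w] (mod int q)"
    by (metis add.right_neutral cong_trans)
  then show ?thesis using 1 unfolding eis_rel_def by blast
qed

lemma eis_rel_of_int: "eis_rel (of_int a) a"
  unfolding eis_rel_def by (rule exI[of _ a], rule exI[of _ 0]) simp

lemma eis_rel_omega: "eis_rel \<omega> w"
  unfolding eis_rel_def by (rule exI[of _ 0], rule exI[of _ 1]) simp

lemma eis_rel_power: "eis_rel z k \<Longrightarrow> eis_rel (z ^ n) (k ^ n)"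
  using eis_rel_of_int[of 1] by (induction n) (auto intro: eis_rel_mult)

lemma eis_rel_sum: "(\<And>i. i \<in> I \<Longrightarrow> eis_rel (f i) (g i)) \<Longrightarrow> eis_rel (sum f I) (sum g I)"
  using eis_rel_of_int[of 0] by (induction I rule: infinite_finite_induct) (auto intro: eis_rel_add)

text \<open>Euler's criterion: \<open>chi\<close> is defined so that sending \<omega> to
  \<open>w\<close> sends \<open>chi x\<close> to \<open>x ^ m\<close>.\<close>

lemma eis_rel_chi: "eis_rel (chi x) (x ^ m)"
proof (cases "int q dvd x")
  case True
  then have "[0 = x ^ m] (mod int q)"
    using m_pos by (metis cong_0_iff cong_sym dvd_power dvd_trans)
  then show ?thesis
    unfolding eis_rel_def chi_0[OF True]
    by (intro exI[of _ 0]) (simp add: cong_sym)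
next
  case False
  then obtain j where j: "[x ^ m = w ^ j] (mod int q)" "chi x = \<omega> ^ j" using chi_cases by blast
  have "eis_rel (\<omega> ^ j) (w ^ j)" by (intro eis_rel_power eis_rel_omega)
  then show ?thesis unfolding eis_rel_def j(2) using j(1) cong_trans by blast
qed

text \<open>Under \<omega> going to \<open>w\<close>, the Jacobi sum becomes a combination of power
  sums with exponents from \<open>m\<close> to \<open>2 m\<close>. These lie strictly between 0 and
  \<open>q - 1 = 3 m\<close>, so every power sum vanishes modulo \<open>q\<close>.\<close>

lemma J_eisenstein:
  obtains a b where "J = of_int a + of_int b * \<omega>" "int q dvd a + b * w"
proof -
  have "eis_rel J (\<Sum>x\<in>{0..<int q}. x ^ m * (1 - x) ^ m)"
    unfolding J_def by (intro eis_rel_sum eis_rel_mult eis_rel_chi)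
  then obtain a b where ab: "J = of_int a + of_int b * \<omega>"
    "[(\<Sum>x\<in>{0..<int q}. x ^ m * (1 - x) ^ m) = a + b * w] (mod int q)"
    unfolding eis_rel_def by blast
  have "(\<Sum>x\<in>{0..<int q}. x ^ m * (1 - x) ^ m) =
      (\<Sum>x\<in>{0..<int q}. \<Sum>i\<le>m. int (m choose i) * (- 1) ^ i * x ^ (m + i))"
  proof (rule sum.cong)
    fix x :: int
    have "(1 - x) ^ m = (\<Sum>i\<le>m. int (m choose i) * (- x) ^ i)"
      using binomial_ring[of "- x" 1 m] by simp
    then show "x ^ m * (1 - x) ^ m = (\<Sum>i\<le>m. int (m choose i) * (- 1) ^ i * x ^ (m + i))"
      by (simp add: sum_distrib_left power_add power_minus[of x] mult_ac)
  qed simp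
  also have "\<dots> = (\<Sum>i\<le>m. int (m choose i) * (- 1) ^ i * (\<Sum>x\<in>{0..<int q}. x ^ (m + i)))"
    by (subst sum.swap) (simp add: sum_distrib_left)
  also have "int q dvd \<dots>"
    using m_pos q_eq by (intro dvd_sum dvd_mult prime_dvd_power_sum prime_q) auto
  finally have "int q dvd a + b * w" using ab(2) cong_dvd_iff by blast
  then show ?thesis using ab(1) that by blast
qed

lemma chi_mem: "chi x \<in> cyclotomic_ring (3 * q)"
  and e_mem: "e x \<in> cyclotomic_ring (3 * q)"
proof -
  have pos: "3 * q > 0" using q_pos by simp
  interpret subring_set "cyclotomic_ring (3 * q)" using pos by (rule subring_cyclotomic_ring)
  have "\<omega> = of_int 1 * unity_root (3 * q) (int q)"
    using unity_root_mult_left[of q 3 1] q_pos by (simp add: mult.commute)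
  then have "\<omega> \<in> cyclotomic_ring (3 * q)"
    using of_int_mult_unity_root_mem[OF pos, of 1 "int q"] by simp
  then show "chi x \<in> cyclotomic_ring (3 * q)"
    by (auto simp: chi_def intro!: zero_mem one_mem power_mem)
  show "e x \<in> cyclotomic_ring (3 * q)"
    using of_int_mult_unity_root_mem[OF pos, of 1 "3 * x"] unity_root_mult_left[of 3 q x] by simp
qed

text \<open>Modulo 3 the cube \<open>q J\<close> of the Gauss sum is the sum of the cubes of its terms, which is \<open>- 1\<close>.\<close>
lemma J_mod_3:
  assumes J: "J = of_int a + of_int b * \<omega>"
  shows "3 dvd a + 1" "3 dvd b"
proof -
  have pos: "3 * q > 0" using q_pos by simp
  interpret subring_set "cyclotomic_ring (3 * q)" using pos by (rule subring_cyclotomic_ring)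
  have "pcong 3 (G ^ 3) (\<Sum>x\<in>{0..<int q}. (chi x * e x) ^ 3)"
    unfolding G_def by (intro pcong_sum_power mult_mem chi_mem e_mem) simp
  also have "(\<Sum>x\<in>{0..<int q}. (chi x * e x) ^ 3) = (\<Sum>x\<in>{0..<int q}. e (3 * x) - (if x = 0 then 1 else 0))"
  proof (rule sum.cong)
    fix x assume x: "x \<in> {0..<int q}"
    show "(chi x * e x) ^ 3 = e (3 * x) - (if x = 0 then 1 else 0)"
    proof (cases "x = 0")
      case False
      then have "\<not> int q dvd x" using x by (auto dest: zdvd_imp_le)
      then show ?thesis using False by (simp add: power_mult_distrib chi_cube unity_root_power)
    qed (simp add: chi_0)
  qed simp
  also have "\<dots> = - 1"
  proof -
    have "\<not> int q dvd 3"
    proof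
      assume "int q dvd 3"
      then have "q \<le> 3" by (auto dest: zdvd_imp_le)
      then show False using q_eq m_pos by simp
    qed
    then show ?thesis using q_pos by (simp add: sum_subtractf sum_unity_root)
  qed
  finally obtain c where c: "c \<in> cyclotomic_ring (3 * q)" "G ^ 3 + 1 = 3 * c"
    unfolding pcong_def by auto
  have Jmem: "J \<in> cyclotomic_ring (3 * q)"
    unfolding J_def by (intro sum_mem mult_mem chi_mem)
  \<comment> \<open>As \<open>q = 3 m + 1\<close>, the multiple \<open>3 m J\<close> moves to the
    other side and leaves \<open>J + 1 = 3 d\<close>.\<close>
  define d where "d = c - of_nat m * J"
  have d: "d \<in> cyclotomic_ring (3 * q)" unfolding d_def using c Jmem by (intro mem_intros)
  have "of_nat q * J + 1 = 3 * c" using c(2) by (simp add: G_cube)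
  then have Jd: "J + 1 = 3 * d" unfolding d_def q_eq by (simp add: algebra_simps)
  \<comment> \<open>\<open>N\<close> is the norm of \<open>J + 1\<close>, hence 9 times
    \<open>d * cnj d\<close>, which is a rational element of the cyclotomic ring and so an
    integer.\<close>
  define N where "N = (a + 1)\<^sup>2 - (a + 1) * b + b\<^sup>2"
  have "9 * (d * cnj d) = (J + 1) * cnj (J + 1)" unfolding Jd by simp
  also have "\<dots> = (of_int (a + 1) + of_int b * \<omega>) * (of_int (a + 1) + of_int b * (- \<omega> - 1))"
    by (simp add: J cnj_omega algebra_simps)
  also have "\<dots> = of_int ((a + 1)\<^sup>2 - (a + 1) * b) - of_int (b\<^sup>2) * (\<omega>\<^sup>2 + \<omega>)"
    by (simp add: algebra_simps power2_eq_square)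
  also have "\<dots> = of_int N" by (simp add: omega_quadratic N_def)
  finally have N: "9 * (d * cnj d) = of_int N" .
  then have "d * cnj d = of_int N / 9" by (metis nonzero_mult_div_cancel_left zero_neq_numeral)
  then have "d * cnj d = of_rat (of_int N / 9)" by (simp add: of_rat_divide)
  then have "d * cnj d \<in> \<int>"
    using d cnj_cyclotomic_ring[OF pos d]
    by (intro rational_cyclotomic_ring[OF pos] mult_mem) (auto simp: Rats_def)
  then obtain k where "d * cnj d = of_int k" by (auto elim: Ints_cases)
  then have "(of_int N :: complex) = of_int (9 * k)" using N by simp
  then have Nk: "N = 9 * k" by (simp only: of_int_eq_iff)
  \<comment> \<open>Divisibility of \<open>N\<close> by 3 only controls \<open>a + 1 + b\<close>;
    after reinserting this, divisibility by 9 controls \<open>a + 1\<close> itself.\<close>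
  have "(a + 1 + b)\<^sup>2 = 3 * (3 * k + (a + 1) * b)"
    using Nk by (simp add: N_def algebra_simps power2_eq_square)
  then have "3 dvd (a + 1 + b)\<^sup>2" by simp
  then have "3 dvd a + 1 + b" by (rule prime_dvd_power[rotated]) simp
  then obtain t where t: "a + 1 + b = 3 * t" by auto
  then have b: "b = 3 * t - (a + 1)" by simp
  have "3 * (a + 1)\<^sup>2 = 9 * (k - t\<^sup>2 + t * (a + 1))"
    using Nk unfolding N_def b by (simp add: algebra_simps power2_eq_square)
  then have "3 dvd (a + 1)\<^sup>2" by presburger
  then show "3 dvd a + 1" by (rule prime_dvd_power[rotated]) simp
  then show "3 dvd b" unfolding b by (intro dvd_diff) auto
qed

text \<open>Both \<open>(L, M)\<close> and the coordinates \<open>(L', M')\<close> of the Jacobi sum represent \<open>4 q\<close>. The composed form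
  \<open>(L L' + 27 M M')\<^sup>2 + 27 (L M' - L' M)\<^sup>2 = 16 q\<^sup>2\<close> has its first square divisible by \<open>q\<^sup>2\<close>
  because of the choice of \<open>w\<close>, which leaves only \<open>16 = 4\<^sup>2 + 27 \<cdot> 0\<^sup>2\<close>.\<close>
lemma J_eq:
  assumes LM: "4 * int q = L\<^sup>2 + 27 * M\<^sup>2" and L: "[L = 1] (mod 3)"
    and wLM: "[2 * L * w = 9 * M - L] (mod int q)"
  shows "2 * J = of_int L + 3 * of_int M * (2 * \<omega> + 1)"
proof -
  obtain a b where J: "J = of_int a + of_int b * \<omega>" and abw: "int q dvd a + b * w"
    by (rule J_eisenstein)
  have a3: "3 dvd a + 1" and b3: "3 dvd b" using J_mod_3[OF J] .
  obtain M' where M': "b = 3 * M'" using b3 by auto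
  \<comment> \<open>This gives \<open>2 J = L' + 3 M' (2 \<omega> + 1)\<close>.\<close>
  define L' where "L' = 2 * a - b"
  have L3: "[L' = 1] (mod 3)"
    using a3 b3 unfolding L'_def cong_iff_dvd_diff by presburger
  have "of_int (a\<^sup>2 - a * b + b\<^sup>2) = J * cnj J"
  proof -
    have "J * cnj J = (of_int a + of_int b * \<omega>) * (of_int a + of_int b * (- \<omega> - 1))"
      by (simp add: J cnj_omega)
    also have "\<dots> = of_int (a\<^sup>2 - a * b) - of_int (b\<^sup>2) * (\<omega>\<^sup>2 + \<omega>)"
      by (simp add: algebra_simps power2_eq_square)
    finally show ?thesis by (simp add: omega_quadratic)
  qed
  then have "(of_int (a\<^sup>2 - a * b + b\<^sup>2) :: complex) = of_int (int q)" by (simp add: J_mult_cnj)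
  then have norm: "a\<^sup>2 - a * b + b\<^sup>2 = int q" by (simp only: of_int_eq_iff)
  have LM': "4 * int q = L'\<^sup>2 + 27 * M'\<^sup>2"
    unfolding norm [symmetric] L'_def M' by (simp add: algebra_simps power2_eq_square)
  \<comment> \<open>Eliminating \<open>w\<close> between the two divisibilities leaves one for
    \<open>L L' + 27 M M'\<close>.\<close>
  have "int q dvd 2 * L * (a + b * w) - b * (2 * L * w - (9 * M - L))"
    by (rule dvd_diff[OF dvd_mult[OF abw] dvd_mult[OF wLM[unfolded cong_iff_dvd_diff]]])
  moreover have "2 * L * (a + b * w) - b * (2 * L * w - (9 * M - L)) = L * L' + 27 * M * M'"
    by (simp add: L'_def M' algebra_simps)
  ultimately obtain s where s: "L * L' + 27 * M * M' = int q * s" by auto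
  define T where "T = L * M' - L' * M"
  have comp: "(int q * s)\<^sup>2 + 27 * T\<^sup>2 = 16 * (int q)\<^sup>2"
  proof -
    have "(L * L' + 27 * M * M')\<^sup>2 + 27 * T\<^sup>2 = (L\<^sup>2 + 27 * M\<^sup>2) * (L'\<^sup>2 + 27 * M'\<^sup>2)"
      by (simp add: T_def algebra_simps power2_eq_square)
    also have "\<dots> = 16 * (int q)\<^sup>2" unfolding LM [symmetric] LM' [symmetric] by (simp add: power2_eq_square)
    finally show ?thesis by (simp only: s)
  qed
  then have "27 * T\<^sup>2 = int q * (int q * (16 - s\<^sup>2))" by (simp add: algebra_simps power2_eq_square)
  then have "int q dvd 27 * T\<^sup>2" by simp
  moreover have "\<not> int q dvd 27"
  proof
    assume "int q dvd 27"
    then have "int q dvd 3 ^ 3" by simp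
    then have "int q dvd 3" using prime_int_q prime_dvd_power by blast
    then have "q \<le> 3" by (auto dest: zdvd_imp_le)
    then show False using q_eq m_pos by simp
  qed
  ultimately have "int q dvd T" using prime_int_q by (auto simp: prime_dvd_mult_iff prime_dvd_power_iff)
  then obtain t where t: "T = int q * t" by auto
  have "(int q)\<^sup>2 * (s\<^sup>2 + 27 * t\<^sup>2) = (int q)\<^sup>2 * 16"
    using comp unfolding t by (simp add: algebra_simps power2_eq_square)
  then have st: "s\<^sup>2 + 27 * t\<^sup>2 = 16" using q_pos by simp
  have "t = 0"
  proof (rule ccontr)
    assume "t \<noteq> 0"
    then have "t\<^sup>2 \<ge> 1" by (simp add: int_one_le_iff_zero_less)
    moreover have "s\<^sup>2 \<ge> 0" by simp
    ultimately show False using st by linarith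
  qed
  then have "s\<^sup>2 = 4\<^sup>2" using st by simp
  then have s4: "s = 4 \<or> s = - 4" by (simp only: power2_eq_iff)
  \<comment> \<open>The sign is decided modulo 3: \<open>L L'\<close> is congruent to 1, whereas
    \<open>s = - 4\<close> would make it congruent to -1.\<close>
  have "s \<noteq> - 4"
  proof
    assume "s = - 4"
    then have "L * L' + 27 * M * M' + 12 * int m + 4 = 0" using s q_eq by simp
    then have "L * L' - 1 = 3 * (- 9 * M * M' - 4 * int m - 2) + 1" by simp
    moreover have "[L * L' = 1 * 1] (mod 3)" by (intro cong_mult L L3)
    then have "3 dvd L * L' - 1" by (simp add: cong_iff_dvd_diff)
    ultimately show False by presburger
  qed
  then have s: "L * L' + 27 * M * M' = 4 * int q" using s s4 by simp
  \<comment> \<open>With \<open>s = 4\<close> the pairing of the two representations of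
    \<open>4 q\<close> is maximal, so their difference has norm zero.\<close>
  have "(L - L')\<^sup>2 + 27 * (M - M')\<^sup>2 =
      (L\<^sup>2 + 27 * M\<^sup>2) + (L'\<^sup>2 + 27 * M'\<^sup>2) - 2 * (L * L' + 27 * M * M')"
    by (simp add: algebra_simps power2_eq_square)
  also have "\<dots> = 0" unfolding s by (simp flip: LM LM')
  finally have sq: "(L - L')\<^sup>2 + 27 * (M - M')\<^sup>2 = 0" .
  moreover have "(L - L')\<^sup>2 \<ge> 0" "(M - M')\<^sup>2 \<ge> 0" by simp_all
  ultimately have "(L - L')\<^sup>2 = 0" "(M - M')\<^sup>2 = 0" by linarith+
  then have "2 * a = L + 3 * M" "b = 3 * M" unfolding L'_def M' by auto
  moreover have "2 * J = of_int (2 * a) + of_int (2 * b) * \<omega>" by (simp add: J algebra_simps)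
  ultimately show ?thesis by (simp add: algebra_simps)
qed

end

section \<open>The Frobenius action on the roots\<close>

lemma omega_mults: "\<omega> * \<omega> = \<omega>\<^sup>2" "\<omega> * \<omega>\<^sup>2 = 1" "\<omega>\<^sup>2 * \<omega> = 1" "\<omega> ^ 4 = \<omega>"
  using omega_cube by (simp_all add: eval_nat_numeral mult.assoc)

lemma of_int_divide_local:
  assumes n: "n > 0" and p: "prime p" and v: "\<not> int p dvd v"
  shows "of_int u / of_int v \<in> local_cyclotomic_ring p n"
    and "subring_set.pcong (local_cyclotomic_ring p n) p ((of_int u / of_int v) ^ p) (of_int u / of_int v)"
proof -
  interpret B: subring_set "local_cyclotomic_ring p n"
    using n p by (rule subring_local_cyclotomic_ring)
  let ?i = "inverse (of_int v :: complex)"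
  have v0: "(of_int v :: complex) \<noteq> 0" using v by auto
  have i: "?i \<in> local_cyclotomic_ring p n" using n p v by (rule inverse_of_int_local_mem)
  show "of_int u / of_int v \<in> local_cyclotomic_ring p n"
    unfolding divide_inverse using i by (intro B.mult_mem B.of_int_mem)
  have fermat: "B.pcong p (of_int a ^ p) (of_int a)" for a
    using B.pcong_of_int[OF int_power_prime_cong[OF p, of a]] by simp
  \<comment> \<open>Fermat for the inverse \<open>i\<close> of \<open>v\<close>:
    \<open>i ^ p = i ^ (p + 1) * v\<close> is congruent to
    \<open>i ^ (p + 1) * v ^ p = i\<close>.\<close>
  have "B.pcong p (?i ^ (p + 1) * of_int v) (?i ^ (p + 1) * of_int v ^ p)"
    using i by (intro B.pcong_mult_left B.power_mem B.pcong_sym[OF fermat])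
  moreover have "?i ^ (p + 1) * of_int v = ?i ^ p" using v0 by simp
  moreover have "?i ^ (p + 1) * of_int v ^ p = ?i"
    using v0 by (simp add: mult.assoc flip: power_mult_distrib)
  ultimately have "B.pcong p (?i ^ p) ?i" by (simp only:)
  then have "B.pcong p (of_int u ^ p * ?i ^ p) (of_int u * ?i)"
    using i by (intro B.pcong_mult fermat B.of_int_mem B.power_mem)
  then show "B.pcong p ((of_int u / of_int v) ^ p) (of_int u / of_int v)"
    by (simp add: divide_inverse power_mult_distrib)
qed

context cubic_character
begin

text \<open>Every \<open>E c\<close> is an integral combination of the \<open>e x\<close>, so that the Frobenius acts on it through
  \<open>e x \<mapsto> e (p x)\<close>.\<close>
lemma frobenius_resolvent:
  fixes \<alpha> \<beta> :: complex and f :: "complex \<Rightarrow> int"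
  assumes p: "prime p" "p \<noteq> q"
    and f: "\<forall>z\<in>{0, 1, \<omega>, \<omega>\<^sup>2}. of_int (f z) = \<alpha> * z + \<beta> * cnj z"
  defines "E \<equiv> \<lambda>c. \<alpha> * c * cnj G + \<beta> * cnj c * G"
  assumes c: "c \<in> {1, \<omega>, \<omega>\<^sup>2}"
  shows "E c \<in> cyclotomic_ring (3 * q)"
    and "subring_set.pcong (cyclotomic_ring (3 * q)) p (E c ^ p) (E (c * chi (int p)))"
proof -
  have pos: "3 * q > 0" using q_pos by simp
  interpret subring_set "cyclotomic_ring (3 * q)" using pos by (rule subring_cyclotomic_ring)
  have Z_mult: "y * z \<in> {0, 1, \<omega>, \<omega>\<^sup>2}" if "y \<in> {0, 1, \<omega>, \<omega>\<^sup>2}" "z \<in> {0, 1, \<omega>, \<omega>\<^sup>2}" for y z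
    using that by (auto simp: omega_mults)
  have chi_Z: "chi x \<in> {0, 1, \<omega>, \<omega>\<^sup>2}" for x by (simp add: chi_def)
  have cnj_chi_Z: "cnj (chi x) \<in> {0, 1, \<omega>, \<omega>\<^sup>2}" for x
    unfolding cnj_chi power2_eq_square[of "chi x"] by (intro Z_mult chi_Z)
  \<comment> \<open>Expanding both Gauss sums, the coefficient of \<open>e x\<close> is
    \<open>\<alpha> * z + \<beta> * cnj z\<close> at \<open>z = d * cnj (chi x)\<close>, an integer
    by \<open>f\<close>.\<close>
  have E: "E d = (\<Sum>x\<in>{0..<int q}. of_int (f (d * cnj (chi x))) * e x)" if d: "d \<in> {1, \<omega>, \<omega>\<^sup>2}" for d
  proof -
    have "d * cnj (chi x) \<in> {0, 1, \<omega>, \<omega>\<^sup>2}" for x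
      using d by (intro Z_mult cnj_chi_Z) auto
    then have "(\<Sum>x\<in>{0..<int q}. of_int (f (d * cnj (chi x))) * e x) =
      (\<Sum>x\<in>{0..<int q}. (\<alpha> * d) * (cnj (chi x) * e x) + (\<beta> * cnj d) * (chi x * e x))"
      by (intro sum.cong refl) (simp only: f[rule_format], simp add: algebra_simps)
    also have "\<dots> = E d" unfolding E_def cnj_G unfolding G_def by (simp only: sum.distrib sum_distrib_left)
    finally show ?thesis ..
  qed
  show "E c \<in> cyclotomic_ring (3 * q)"
    unfolding E[OF c] by (intro sum_mem mult_mem of_int_mem e_mem)
  have pq: "\<not> int q dvd int p" using p prime_q by (simp add: primes_dvd_imp_eq) (metis primes_dvd_imp_eq)
  have cp: "c * chi (int p) \<in> {1, \<omega>, \<omega>\<^sup>2}"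
  proof -
    have "c * chi (int p) \<in> {0, 1, \<omega>, \<omega>\<^sup>2}" using c by (intro Z_mult chi_Z) auto
    moreover have "c * chi (int p) \<noteq> 0"
      using c chi_cube[OF pq] omega_cube by (auto simp: power_0_left)
    ultimately show ?thesis by auto
  qed
  have "pcong p (E c ^ p) (\<Sum>x\<in>{0..<int q}. (of_int (f (c * cnj (chi x))) * e x) ^ p)"
    unfolding E[OF c] by (intro pcong_sum_power p mult_mem of_int_mem e_mem)
  also have "pcong p \<dots> (\<Sum>x\<in>{0..<int q}. of_int (f (c * cnj (chi x))) * e (int p * x))"
  proof (rule pcong_sum)
    fix x
    have "pcong p (of_int (f (c * cnj (chi x)) ^ p)) (of_int (f (c * cnj (chi x))))"
      by (intro pcong_of_int int_power_prime_cong p)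
    then have "pcong p (e x ^ p * of_int (f (c * cnj (chi x))) ^ p) (e x ^ p * of_int (f (c * cnj (chi x))))"
      unfolding of_int_power by (intro pcong_mult_left power_mem e_mem)
    then show "pcong p ((of_int (f (c * cnj (chi x))) * e x) ^ p) (of_int (f (c * cnj (chi x))) * e (int p * x))"
      by (simp add: power_mult_distrib unity_root_power mult.commute)
  qed
  \<comment> \<open>Since \<open>chi p * cnj (chi p) = 1\<close>, the coefficient can be expressed
    through \<open>p * x\<close>; replacing \<open>p * x\<close> by \<open>x\<close> then turns
    \<open>c\<close> into \<open>c * chi p\<close>.\<close>
  also have "(\<Sum>x\<in>{0..<int q}. of_int (f (c * cnj (chi x))) * e (int p * x)) =
    (\<Sum>x\<in>{0..<int q}. of_int (f (c * chi (int p) * cnj (chi (int p * x)))) * e (int p * x))"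
    by (simp add: chi_mult mult.assoc chi_cnj[OF pq] flip: mult.assoc[of "chi (int p)"])
  also have "\<dots> = (\<Sum>x\<in>{0..<int q}. of_int (f (c * chi (int p) * cnj (chi x))) * e x)"
    using pq by (intro sum_residues_mult) (simp_all add: chi_mod e_mod)
  also have "\<dots> = E (c * chi (int p))" by (rule E[OF cp, symmetric])
  finally show "pcong p (E c ^ p) (E (c * chi (int p)))" .
qed

text \<open>Cardano's form of the roots: with \<open>u = \<kappa> * \<alpha> * cnj G\<close> and
  \<open>v = \<kappa> * \<beta> * G\<close> they are \<open>\<zeta> * u + cnj \<zeta> * v\<close>
  for the cube roots of unity \<open>\<zeta>\<close>. Then \<open>e2\<close> and \<open>e3\<close>
  say \<open>3 u v = y\<close> and \<open>u ^ 3 + v ^ 3 = y\<close>, and \<open>\<delta>\<close>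
  inverts the product of root differences. The Frobenius permutes the roots cyclically according to
  \<open>chi p\<close>.\<close>

lemma sum_choose_3k_k_resolvent:
  fixes \<alpha> \<beta> \<kappa> x y \<delta> :: complex and f :: "complex \<Rightarrow> int" and p :: nat
  defines "B \<equiv> local_cyclotomic_ring p (3 * q)"
  defines "S \<equiv> \<Sum>k = (p + 1) div 2..(2 * p) div 3. of_nat ((3 * k) choose k) * x ^ k"
  assumes p: "prime p" "p > 3" "p \<noteq> q"
    and f: "\<forall>z\<in>{0, 1, \<omega>, \<omega>\<^sup>2}. of_int (f z) = \<alpha> * z + \<beta> * cnj z"
    and \<kappa>: "\<kappa> \<in> B" "subring_set.pcong B p (\<kappa> ^ p) \<kappa>"
    and x: "x \<in> B" "subring_set.pcong B p (x ^ p) x" and y: "y \<in> B" and xy: "x * y = 1"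
    and e2: "3 * \<alpha> * \<beta> * \<kappa>\<^sup>2 * of_nat q = y"
    and e3: "\<kappa> ^ 3 * of_nat q * (\<alpha> ^ 3 * cnj J + \<beta> ^ 3 * J) = y"
    and \<delta>: "\<delta> \<in> B" "- 3 * (2 * \<omega> + 1) * \<kappa> ^ 3 * of_nat q * (\<alpha> ^ 3 * cnj J - \<beta> ^ 3 * J) * \<delta> = 1"
  shows "chi (int p) = 1 \<Longrightarrow> subring_set.pcong B p S 0"
    and "chi (int p) = \<omega> \<Longrightarrow> subring_set.pcong B p S (3 * y * \<delta>)"
    and "chi (int p) = \<omega>\<^sup>2 \<Longrightarrow> subring_set.pcong B p S (- (3 * y * \<delta>))"
proof -
  have pos: "3 * q > 0" using q_pos by simp
  interpret A: subring_set "cyclotomic_ring (3 * q)" using pos by (rule subring_cyclotomic_ring)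
  interpret subring_set B unfolding B_def using pos p(1) by (rule subring_local_cyclotomic_ring)
  have AB: "cyclotomic_ring (3 * q) \<subseteq> B" unfolding B_def using p(1) by (rule cyclotomic_ring_subset_local)
  define E where "E = (\<lambda>c. \<alpha> * c * cnj G + \<beta> * cnj c * G)"
  have E_mem: "\<kappa> * E c \<in> B" and E_frob: "pcong p ((\<kappa> * E c) ^ p) (\<kappa> * E (c * chi (int p)))"
    if c: "c \<in> {1, \<omega>, \<omega>\<^sup>2}" for c
  proof -
    have Ec: "E c \<in> B" using frobenius_resolvent(1)[OF p(1,3) f c] AB by (auto simp: E_def)
    then show "\<kappa> * E c \<in> B" using \<kappa> by (intro mult_mem)
    have "A.pcong p (E c ^ p) (E (c * chi (int p)))"
      using frobenius_resolvent(2)[OF p(1,3) f c] by (simp add: E_def)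
    then have "pcong p (E c ^ p) (E (c * chi (int p)))"
      using AB unfolding A.pcong_def pcong_def by blast
    then show "pcong p ((\<kappa> * E c) ^ p) (\<kappa> * E (c * chi (int p)))"
      unfolding power_mult_distrib using \<kappa> Ec by (intro pcong_mult power_mem)
  qed
  define a where "a = \<kappa> * E 1"
  define b where "b = \<kappa> * E \<omega>"
  define c where "c = \<kappa> * E (\<omega>\<^sup>2)"
  define u where "u = \<kappa> * \<alpha> * cnj G"
  define v where "v = \<kappa> * \<beta> * G"
  have abc: "a = u + v" "b = u * \<omega> + v * (- \<omega> - 1)" "c = u * (- \<omega> - 1) + v * \<omega>"
    unfolding a_def b_def c_def u_def v_def E_def
    by (simp_all add: cnj_omega omega_quadratic algebra_simps)
  have cube: "cnj G ^ 3 = of_nat q * cnj J"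
    using arg_cong[OF G_cube, of cnj] by simp
  have uv: "3 * u * v = y"
  proof -
    have "3 * u * v = 3 * \<alpha> * \<beta> * \<kappa>\<^sup>2 * (G * cnj G)"
      by (simp add: u_def v_def power2_eq_square mult_ac)
    then show ?thesis using e2 by (simp add: G_mult_cnj)
  qed
  have u3v3: "u ^ 3 + v ^ 3 = y"
    using e3 by (simp add: u_def v_def power_mult_distrib cube G_cube algebra_simps)
  have ww: "\<omega> * \<omega> = - \<omega> - 1" using omega_quadratic by (simp add: power2_eq_square)
  have ww': "\<omega> * (\<omega> * z) = (- \<omega> - 1) * z" for z by (simp add: ww flip: mult.assoc)
  have 1: "a + b + c = 0" unfolding abc by (simp add: algebra_simps)
  have 2: "a * b + b * c + c * a = - y"
    unfolding abc uv [symmetric] by (simp add: algebra_simps ww ww')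
  have 3: "a * b * c = y"
    unfolding abc u3v3 [symmetric] by (simp add: algebra_simps ww ww' power3_eq_cube)
  have "(a - b) * (b - c) * (c - a) = - 3 * (2 * \<omega> + 1) * (u ^ 3 - v ^ 3)"
    unfolding abc by (simp add: algebra_simps ww ww' power3_eq_cube)
  also have "\<dots> * \<delta> = 1"
    using \<delta>(2) by (simp add: u_def v_def power_mult_distrib cube G_cube algebra_simps)
  finally have 4: "(a - b) * (b - c) * (c - a) * \<delta> = 1" .
  \<comment> \<open>Multiplication by the inverse \<open>y\<close> cancels one factor
    \<open>x\<close> in the Frobenius congruence for \<open>x\<close>.\<close>
  have xp: "pcong p (x ^ (p - 1)) 1"
  proof -
    have "x ^ p = x * x ^ (p - 1)" using p(2) by (metis power_minus_mult mult.commute gr_zeroI not_less_zero)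
    then have "y * x ^ p = x ^ (p - 1)" using xy by (simp add: mult_ac flip: mult.assoc)
    moreover have "pcong p (y * x ^ p) (y * x)" using x y by (intro pcong_mult_left)
    ultimately show ?thesis using xy by (simp add: mult.commute)
  qed
  have main: "pcong p S (\<delta> * ((b - c) * a' + (c - a) * b' + (a - b) * c'))"
    if "pcong p (a ^ p) a'" "pcong p (b ^ p) b'" "pcong p (c ^ p) c'" for a' b' c'
    unfolding S_def
  proof (rule sum_choose_3k_k_pcong_roots[OF p(1,2) x(1) y xy xp _ _ _ 1 2 3 \<delta>(1) 4 that])
    show "a \<in> B" "b \<in> B" "c \<in> B" unfolding a_def b_def c_def by (intro E_mem; simp)+
  qed
  have frob: "pcong p (a ^ p) (\<kappa> * E (chi (int p)))" "pcong p (b ^ p) (\<kappa> * E (\<omega> * chi (int p)))"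
    "pcong p (c ^ p) (\<kappa> * E (\<omega>\<^sup>2 * chi (int p)))"
    using E_frob[of 1] E_frob[of \<omega>] E_frob[of "\<omega>\<^sup>2"] by (simp_all add: a_def b_def c_def)
  have sq: "a * a + b * b + c * c = 2 * y"
  proof -
    have "a * a + b * b + c * c = (a + b + c) * (a + b + c) - 2 * (a * b + b * c + c * a)"
      by (simp add: algebra_simps)
    then show ?thesis unfolding 1 2 by simp
  qed
  show "pcong p S 0" if "chi (int p) = 1"
  proof -
    have "pcong p S (\<delta> * ((b - c) * a + (c - a) * b + (a - b) * c))"
      using frob that by (intro main) (simp_all add: a_def b_def c_def)
    then show ?thesis by (simp add: algebra_simps)
  qed
  \<comment> \<open>The Frobenius sends \<open>a\<close> to \<open>b\<close>, \<open>b\<close> to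
    \<open>c\<close> and \<open>c\<close> to \<open>a\<close>, so the bracket is the sum of squares
    minus the second symmetric function, \<open>2 y + y\<close>. The remaining case is the inverse
    cycle with the opposite sign.\<close>
  show "pcong p S (3 * y * \<delta>)" if "chi (int p) = \<omega>"
  proof -
    have "pcong p S (\<delta> * ((b - c) * b + (c - a) * c + (a - b) * a))"
      using frob that by (intro main) (simp_all add: a_def b_def c_def omega_mults)
    also have "(b - c) * b + (c - a) * c + (a - b) * a =
        (a * a + b * b + c * c) - (a * b + b * c + c * a)" by (simp add: algebra_simps)
    finally show ?thesis unfolding sq 2 by (simp add: mult_ac)
  qed
  show "pcong p S (- (3 * y * \<delta>))" if "chi (int p) = \<omega>\<^sup>2"
  proof -
    have "pcong p S (\<delta> * ((b - c) * c + (c - a) * a + (a - b) * b))"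
      using frob that by (intro main) (simp_all add: a_def b_def c_def omega_mults)
    also have "(b - c) * c + (c - a) * a + (a - b) * b =
        (a * b + b * c + c * a) - (a * a + b * b + c * c)" by (simp add: algebra_simps)
    finally show ?thesis unfolding sq 2 by (simp add: mult_ac)
  qed
qed

end


theorem theorem25:
  fixes p q :: nat and L M :: int
  assumes "prime q" and "[q = 1] (mod 3)"
    and "4 * int q = L\<^sup>2 + 27 * M\<^sup>2" and "[L = 1] (mod 3)"
    and "prime p" and "p \<noteq> 2" and "p \<noteq> 3" and "p \<noteq> q"
    and "\<not> int p dvd L * M"
  shows
    "([p ^ ((q - 1) div 3) = 1] (mod q) \<longrightarrow>
        rat_cong
          (\<Sum>k = (p + 1) div 2..(2 * p) div 3.
             of_nat ((3 * k) choose k) * (of_int M ^ (2 * k) / of_nat q ^ k))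
          0 (int p))
     \<and> (\<forall>s \<in> {1, -1 :: rat}.
          rat_cong (of_nat (p ^ ((q - 1) div 3))) ((-1 + s * (9 * of_int M / of_int L)) / 2) (int q) \<longrightarrow>
          rat_cong
            (\<Sum>k = (p + 1) div 2..(2 * p) div 3.
               of_nat ((3 * k) choose k) * (of_int M ^ (2 * k) / of_nat q ^ k))
            (s * (3 * of_int M / of_int L)) (int p))
     \<and> ([p ^ ((q - 1) div 3) = 1] (mod q) \<longrightarrow>
        rat_cong
          (\<Sum>k = (p + 1) div 2..(2 * p) div 3.
             of_nat ((3 * k) choose k) * (of_int L ^ (2 * k) / (27 * of_nat q) ^ k))
          0 (int p))
     \<and> (\<forall>s \<in> {1, -1 :: rat}.
          rat_cong (of_nat (p ^ ((q - 1) div 3))) ((-1 + s * (of_int L / (3 * of_int M))) / 2) (int q) \<longrightarrow>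
          rat_cong
            (\<Sum>k = (p + 1) div 2..(2 * p) div 3.
               of_nat ((3 * k) choose k) * (of_int L ^ (2 * k) / (27 * of_nat q) ^ k))
            (s * (of_int L / (9 * of_int M))) (int p))"
proof -

  \<comment> \<open>Arithmetic of \<open>q\<close>, \<open>L\<close>, \<open>M\<close> and the
    choice of \<open>w\<close>\<close>
  note LM = assms(3)
  define m where "m = (q - 1) div 3"
  have q1: "q > 1" using assms(1) by (rule prime_gt_1_nat)
  have q_eq: "q = 3 * m + 1"
  proof -
    have "q mod 3 = 1" using assms(2) by (simp add: cong_def)
    then have "q = 3 * (q div 3) + 1" by presburger
    then show ?thesis unfolding m_def by presburger
  qed
  have prime_iq: "prime (int q)" and prime_ip: "prime (int p)" using assms(1,5) by simp_all
  have p3: "p > 3"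
    using assms(5-7) prime_ge_2_nat[of p] by linarith
  have q_gt: "q > 3" using q1 q_eq by presburger
  have q_ndvd: "\<not> int q dvd 2" "\<not> int q dvd 3"
    using q_gt by (auto dest: zdvd_imp_le)
  \<comment> \<open>Otherwise \<open>q ^ 2\<close> would divide \<open>4 q\<close>, so that
    \<open>q\<close> would divide 4.\<close>
  have qLM_imp: False if "int q dvd L" "int q dvd M"
  proof -
    have "int q * int q dvd L * L + 27 * (M * M)"
      using that by (intro dvd_add dvd_mult mult_dvd_mono)
    then have "int q * int q dvd int q * 4" using LM by (simp add: power2_eq_square mult.commute)
    then have "int q dvd 2 * 2" using q1 by simp
    then show False using q_ndvd prime_iq by (metis prime_dvd_mult_iff)
  qed
  have qL: "\<not> int q dvd L"
  proof
    assume qL: "int q dvd L"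
    have "27 * M\<^sup>2 = int q * 4 - L\<^sup>2" using LM by simp
    also have "int q dvd \<dots>" using qL by (intro dvd_diff) (auto simp: power2_eq_square)
    finally have "int q dvd 3 ^ 3 * M\<^sup>2" by simp
    then have "int q dvd 3 ^ 3 \<or> int q dvd M\<^sup>2" using prime_iq by (simp only: prime_dvd_mult_iff)
    then show False using qL qLM_imp q_ndvd(2) prime_iq prime_dvd_power by blast
  qed
  have qM: "\<not> int q dvd 3 * M"
  proof
    assume "int q dvd 3 * M"
    then have qM: "int q dvd M" using q_ndvd prime_iq by (metis prime_dvd_mult_iff)
    have "L\<^sup>2 = int q * 4 - 27 * M\<^sup>2" using LM by simp
    also have "int q dvd \<dots>" using qM by (intro dvd_diff) (auto simp: power2_eq_square)
    finally show False using qL prime_iq prime_dvd_power by blast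
  qed
  have q2L: "\<not> int q dvd 2 * L" using qL q_ndvd prime_iq by (metis prime_dvd_mult_iff)
  have cop: "coprime (2 * L) (int q)"
    using q2L prime_iq by (metis coprime_commute prime_imp_coprime)
  obtain i where i: "[2 * L * i = 1] (mod int q)"
    using cop cong_solve_coprime_int by blast
  \<comment> \<open>As \<open>i\<close> inverts \<open>2 L\<close>, this is
    \<open>(- 1 + 9 M / L) / 2\<close> modulo \<open>q\<close>, the cube root of unity that
    \<open>J_eq\<close> assumes.\<close>
  define w where "w = (9 * M - L) * i"
  have wL: "[2 * L * w = 9 * M - L] (mod int q)"
    using cong_mult[OF cong_refl[of "9 * M - L"] i] by (simp add: w_def mult_ac)
  have w2: "[w\<^sup>2 + w + 1 = 0] (mod int q)"
  proof -
    \<comment> \<open>Multiplied by \<open>4 L ^ 2\<close>, the expression becomes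
      \<open>3 (L ^ 2 + 27 M ^ 2) = 12 q\<close> modulo \<open>q\<close>.\<close>
    have "(2 * L) * (2 * L) * (w\<^sup>2 + w + 1) = (2 * L * w)\<^sup>2 + 2 * L * (2 * L * w) + 4 * L\<^sup>2"
      by (simp add: algebra_simps power2_eq_square)
    also have "[\<dots> = (9 * M - L)\<^sup>2 + 2 * L * (9 * M - L) + 4 * L\<^sup>2] (mod int q)"
      by (intro cong_add cong_mult cong_pow cong_refl wL)
    also have "(9 * M - L)\<^sup>2 + 2 * L * (9 * M - L) + 4 * L\<^sup>2 = 3 * (L\<^sup>2 + 27 * M\<^sup>2)"
      by (simp add: algebra_simps power2_eq_square)
    also have "\<dots> = int q * 12" using LM by simp
    finally have "int q dvd (2 * L) * (2 * L) * (w\<^sup>2 + w + 1)"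
      by (metis cong_dvd_iff dvd_triv_left)
    then show ?thesis using q2L prime_iq by (metis prime_dvd_mult_iff cong_0_iff)
  qed
  interpret cubic_character q m w
    using assms(1) q_eq w2 by unfold_locales
  have J: "2 * J = of_int L + 3 * of_int M * (2 * \<omega> + 1)"
    using LM assms(4) wL by (rule J_eq)
  have qp: "\<not> int q dvd int p" "\<not> int p dvd int q"
    using assms(1,5,8) primes_dvd_imp_eq by (auto simp: int_dvd_int_iff)

  \<comment> \<open>The value \<open>chi p\<close> read off from \<open>p ^ m\<close> modulo
    \<open>q\<close>\<close>
  have chi1: "chi (int p) = 1" if "[p ^ m = 1] (mod q)"
  proof -
    have "[int p ^ m = w ^ 0] (mod int q)"
      using that by (metis cong_int_iff of_nat_1 of_nat_power power_0)
    then show ?thesis using chi_eq[OF qp(1), of 0] by simp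
  qed
  have chi2: "chi (int p) = \<omega>" if "int q dvd 2 * L * int (p ^ m) - (9 * M - L)"
  proof -
    have "[2 * L * int (p ^ m) = 2 * L * w] (mod int q)"
      using that wL by (metis cong_iff_dvd_diff cong_sym cong_trans)
    then have "[int p ^ m = w ^ 1] (mod int q)" using cop by (simp add: cong_mult_lcancel)
    then show ?thesis using chi_eq[OF qp(1), of 1] by simp
  qed
  have chi3: "chi (int p) = \<omega>\<^sup>2" if "int q dvd 2 * L * int (p ^ m) - (- 9 * M - L)"
  proof -
    \<comment> \<open>The other residue \<open>(- 1 - 9 M / L) / 2\<close> is
      \<open>- 1 - w\<close>, which is \<open>w ^ 2\<close> modulo \<open>q\<close>.\<close>
    have "int q dvd (2 * L * int (p ^ m) - (- 9 * M - L)) + (2 * L * w - (9 * M - L)) - 2 * L * (w\<^sup>2 + w + 1)"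
      using that wL w2 by (metis cong_iff_dvd_diff cong_0_iff dvd_add dvd_diff dvd_mult)
    then have "int q dvd (2 * L) * (int (p ^ m) - w\<^sup>2)" by (simp add: algebra_simps)
    then have "[int p ^ m = w ^ 2] (mod int q)"
      using q2L prime_iq by (simp add: prime_dvd_mult_iff cong_iff_dvd_diff)
    then show ?thesis by (rule chi_eq[OF qp(1)])
  qed

  \<comment> \<open>Denominators prime to \<open>p\<close>, and the trace of
    \<open>J\<close>\<close>
  have pos: "3 * q > 0" using q1 by simp
  let ?B = "local_cyclotomic_ring p (3 * q)"
  interpret B: subring_set ?B using pos assms(5) by (rule subring_local_cyclotomic_ring)
  have pLM: "\<not> int p dvd L" "\<not> int p dvd M" using assms(9) by auto
  then have LM0: "L \<noteq> 0" "M \<noteq> 0" by auto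
  have p_ndvd3: "\<not> int p dvd 3" using p3 by (auto dest: zdvd_imp_le)
  have p9: "\<not> int p dvd 9 * M"
  proof
    assume "int p dvd 9 * M"
    then have "int p dvd 3 * (3 * M)" by simp
    then show False using p_ndvd3 pLM prime_ip by (metis prime_dvd_mult_iff)
  qed
  have p27: "\<not> int p dvd 27 * int q"
  proof
    assume "int p dvd 27 * int q"
    then have "int p dvd 3 * (3 * (3 * int q))" by simp
    then show False using p_ndvd3 qp prime_ip by (metis prime_dvd_mult_iff)
  qed
  note int_frac = of_int_divide_local[OF pos assms(5)]
  have ww: "\<omega> * \<omega> = - \<omega> - 1" using omega_quadratic by (simp add: power2_eq_square)
  \<comment> \<open>A square root of -3.\<close>
  define s3 where "s3 = 2 * \<omega> + 1"
  have s3: "s3 * s3 = - 3" "cnj s3 = - s3"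
    by (simp_all add: s3_def algebra_simps ww cnj_omega)
  then have s30: "s3 \<noteq> 0" by auto
  have cnjJ: "2 * cnj J = of_int L - 3 * of_int M * s3"
    using arg_cong[OF J, of cnj] s3 unfolding s3_def [symmetric] by simp
  note J = J[folded s3_def]

  define S1 where "S1 = (\<Sum>k = (p + 1) div 2..(2 * p) div 3.
    of_nat ((3 * k) choose k) * ((of_int M ^ (2 * k) / of_nat q ^ k) :: rat))"
  define S2 where "S2 = (\<Sum>k = (p + 1) div 2..(2 * p) div 3.
    of_nat ((3 * k) choose k) * ((of_int L ^ (2 * k) / (27 * of_nat q) ^ k) :: rat))"
  define x1 where "x1 = (of_int (M\<^sup>2) / of_int (int q) :: complex)"
  define x2 where "x2 = (of_int (L\<^sup>2) / of_int (27 * int q) :: complex)"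
  have S1: "of_rat S1 = (\<Sum>k = (p + 1) div 2..(2 * p) div 3. of_nat ((3 * k) choose k) * x1 ^ k)"
    unfolding S1_def x1_def
    by (simp add: of_rat_sum of_rat_mult of_rat_divide of_rat_power power_divide power_mult)
  have S2: "of_rat S2 = (\<Sum>k = (p + 1) div 2..(2 * p) div 3. of_nat ((3 * k) choose k) * x2 ^ k)"
    unfolding S2_def x2_def
    by (simp add: of_rat_sum of_rat_mult of_rat_divide of_rat_power power_divide power_mult)
  have x1: "x1 \<in> ?B" "B.pcong p (x1 ^ p) x1" unfolding x1_def using qp by (intro int_frac; simp)+
  have x2: "x2 \<in> ?B" "B.pcong p (x2 ^ p) x2" unfolding x2_def using p27 by (intro int_frac; assumption)+
  have S1_mem: "of_rat S1 \<in> ?B" unfolding S1 using x1 by (intro B.mem_intros)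
  have S2_mem: "of_rat S2 \<in> ?B" unfolding S2 using x2 by (intro B.mem_intros)
  have pM2: "\<not> int p dvd M\<^sup>2" and pL2: "\<not> int p dvd L\<^sup>2"
    using pLM prime_ip prime_dvd_power by blast+
  have pqL: "\<not> int p dvd int q * L"
    using pLM qp prime_ip by (metis prime_dvd_mult_iff)
  have p27M: "\<not> int p dvd 27 * int q * (3 * (9 * M))"
    using p27 p9 p_ndvd3 prime_ip by (metis prime_dvd_mult_iff)
  have ne: "\<omega> \<noteq> 1" "\<omega> \<noteq> 0" "\<omega>\<^sup>2 \<noteq> 1" "\<omega>\<^sup>2 \<noteq> \<omega>" "\<omega>\<^sup>2 \<noteq> 0"
  proof -
    show "\<omega> \<noteq> 1" "\<omega>\<^sup>2 \<noteq> 1" by (auto simp: unity_root_power unity_root_eq_1_iff)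
    show "\<omega> \<noteq> 0" using omega_cube by auto
    then show "\<omega>\<^sup>2 \<noteq> \<omega>" "\<omega>\<^sup>2 \<noteq> 0" using \<open>\<omega> \<noteq> 1\<close> by (auto simp: power2_eq_square)
  qed
  have sum_J: "cnj J + J = of_int L" and diff_J: "cnj J - J = - 3 * of_int M * s3"
  proof -
    have "2 * (cnj J + J) = 2 * of_int L" "2 * (cnj J - J) = 2 * (- 3 * of_int M * s3)"
      using J cnjJ by (simp_all only: distrib_left right_diff_distrib) simp_all
    then show "cnj J + J = of_int L" "cnj J - J = - 3 * of_int M * s3"
      by (simp_all only: mult_left_cancel[OF zero_neq_numeral[symmetric]])
  qed
  have q0: "(of_nat q :: complex) \<noteq> 0" using q1 by simp

  \<comment> \<open>First sum: resolvents built from \<open>z - cnj z\<close>\<close>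
  define f1 :: "complex \<Rightarrow> int" where "f1 z = (if z = \<omega> then 1 else if z = \<omega>\<^sup>2 then - 1 else 0)" for z
  have f1: "\<forall>z\<in>{0, 1, \<omega>, \<omega>\<^sup>2}. of_int (f1 z) = (1 / s3) * z + (- 1 / s3) * cnj z"
  proof
    fix z assume z: "z \<in> {0, 1, \<omega>, \<omega>\<^sup>2}"
    have "\<omega> - cnj \<omega> = s3" "\<omega>\<^sup>2 - cnj (\<omega>\<^sup>2) = - s3"
      by (simp_all add: s3_def cnj_omega omega_quadratic)
    then have "of_int (f1 z) * s3 = z - cnj z"
      using z ne by (auto simp: f1_def)
    then show "of_int (f1 z) = (1 / s3) * z + (- 1 / s3) * cnj z" using s30 by (simp add: field_simps)
  qed
  define y1 where "y1 = (of_int (int q) / of_int (M\<^sup>2) :: complex)"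
  \<comment> \<open>The product of root differences is \<open>q L / M ^ 3\<close>, and this is its
    inverse.\<close>
  define d1 where "d1 = (of_int (M ^ 3) / of_int (int q * L) :: complex)"
  define k1 where "k1 = (of_int 1 / of_int M :: complex)"
  have k1: "k1 \<in> ?B" "B.pcong p (k1 ^ p) k1" unfolding k1_def using pLM by (intro int_frac; simp)+
  have y1: "y1 \<in> ?B" unfolding y1_def using pM2 by (rule int_frac)
  have d1: "d1 \<in> ?B" unfolding d1_def using pqL by (rule int_frac)
  have xy1: "x1 * y1 = 1" using q1 LM0 by (simp add: x1_def y1_def)
  have i3: "(1 / s3) ^ 3 = - 1 / (3 * s3)" "(- 1 / s3) ^ 3 = 1 / (3 * s3)"
    using s3(1) s30 by (simp_all add: power3_eq_cube field_simps)
  have e21: "3 * (1 / s3) * (- 1 / s3) * k1\<^sup>2 * of_nat q = y1"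
  proof -
    have "3 * (1 / s3) * (- 1 / s3) = - 3 / (s3 * s3)" by simp
    also have "\<dots> = 1" unfolding s3 by simp
    finally show ?thesis by (simp add: k1_def y1_def power_divide)
  qed
  have e31: "k1 ^ 3 * of_nat q * ((1 / s3) ^ 3 * cnj J + (- 1 / s3) ^ 3 * J) = y1"
  proof -
    have "(1 / s3) ^ 3 * cnj J + (- 1 / s3) ^ 3 * J = - (cnj J - J) / (3 * s3)"
      unfolding i3 by (simp add: diff_divide_distrib)
    also have "\<dots> = of_int M" unfolding diff_J using s30 by simp
    finally show ?thesis using LM0 by (simp add: k1_def y1_def power_divide eval_nat_numeral)
  qed
  have d1_eq: "- 3 * (2 * \<omega> + 1) * k1 ^ 3 * of_nat q *
      ((1 / s3) ^ 3 * cnj J - (- 1 / s3) ^ 3 * J) * d1 = 1"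
  proof -
    have "(1 / s3) ^ 3 * cnj J - (- 1 / s3) ^ 3 * J = - (cnj J + J) / (3 * s3)"
      unfolding i3 by (simp add: diff_divide_distrib)
    also have "\<dots> = - of_int L / (3 * s3)" unfolding sum_J ..
    finally show ?thesis unfolding s3_def [symmetric]
      using LM0 s30 q0 by (simp add: k1_def d1_def power_divide)
  qed
  have yd1: "3 * y1 * d1 = of_rat (3 * of_int M / of_int L)"
    using LM0 q0 by (simp add: y1_def d1_def of_rat_divide of_rat_mult field_simps eval_nat_numeral)
  note sum1 = sum_choose_3k_k_resolvent[OF assms(5) p3 assms(8) f1 k1 x1 y1 xy1 e21 e31 d1 d1_eq,
      folded S1, unfolded yd1]

  \<comment> \<open>Second sum: resolvents built from \<open>z + cnj z\<close>\<close>
  define f2 :: "complex \<Rightarrow> int" where "f2 z = (if z = 0 then 0 else if z = 1 then 2 else - 1)" for z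
  have f2: "\<forall>z\<in>{0, 1, \<omega>, \<omega>\<^sup>2}. of_int (f2 z) = 1 * z + 1 * cnj z"
  proof
    fix z assume z: "z \<in> {0, 1, \<omega>, \<omega>\<^sup>2}"
    have "\<omega> + cnj \<omega> = - 1" "\<omega>\<^sup>2 + cnj (\<omega>\<^sup>2) = - 1"
      by (simp_all add: cnj_omega omega_quadratic)
    then show "of_int (f2 z) = 1 * z + 1 * cnj z" using z ne by (auto simp: f2_def)
  qed
  define y2 where "y2 = (of_int (27 * int q) / of_int (L\<^sup>2) :: complex)"
  \<comment> \<open>The product of root differences is now \<open>- 729 q M / L ^ 3\<close>.\<close>
  define d2 where "d2 = (of_int (- (L ^ 3)) / of_int (27 * int q * (3 * (9 * M))) :: complex)"
  define k2 where "k2 = (of_int 3 / of_int L :: complex)"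
  have k2: "k2 \<in> ?B" "B.pcong p (k2 ^ p) k2" unfolding k2_def using pLM by (intro int_frac; simp)+
  have y2: "y2 \<in> ?B" unfolding y2_def using pL2 by (rule int_frac)
  have d2: "d2 \<in> ?B" unfolding d2_def using p27M by (rule int_frac)
  have xy2: "x2 * y2 = 1" using q1 LM0 by (simp add: x2_def y2_def)
  have e22: "3 * 1 * 1 * k2\<^sup>2 * of_nat q = y2"
    by (simp add: k2_def y2_def power_divide)
  have e32: "k2 ^ 3 * of_nat q * (1 ^ 3 * cnj J + 1 ^ 3 * J) = y2"
    using LM0 by (simp add: sum_J k2_def y2_def power_divide eval_nat_numeral)
  have d2_eq: "- 3 * (2 * \<omega> + 1) * k2 ^ 3 * of_nat q * (1 ^ 3 * cnj J - 1 ^ 3 * J) * d2 = 1"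
  proof -
    have "- 3 * (2 * \<omega> + 1) * k2 ^ 3 * of_nat q * (1 ^ 3 * cnj J - 1 ^ 3 * J) * d2 =
        9 * (s3 * s3) * k2 ^ 3 * of_nat q * of_int M * d2"
      unfolding s3_def [symmetric] power_one mult_1 diff_J by simp
    also have "\<dots> = 1" unfolding s3 using LM0 q0 by (simp add: k2_def d2_def power_divide)
    finally show ?thesis .
  qed
  \<comment> \<open>The minus sign, absent for the first sum, makes the cases
    \<open>chi p = \<omega>\<close> and \<open>chi p = \<omega>\<^sup>2\<close> trade places
    below.\<close>
  have yd2: "3 * y2 * d2 = - of_rat (of_int L / (9 * of_int M))"
    using LM0 q0 by (simp add: y2_def d2_def of_rat_divide of_rat_mult field_simps eval_nat_numeral)
  note sum2 = sum_choose_3k_k_resolvent[OF assms(5) p3 assms(8) f2 k2 x2 y2 xy2 e22 e32 d2 d2_eq,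
      folded S2, unfolded yd2]

  \<comment> \<open>Transfer to congruences between rationals\<close>
  note fin = rat_cong_local[OF pos assms(5)]
  have mem1: "of_rat (s * (3 * of_int M / of_int L)) \<in> ?B" if "s \<in> {1, -1}" for s
  proof -
    have "of_int (3 * M) / of_int L \<in> ?B" using pLM by (intro int_frac)
    then show ?thesis using that B.uminus_mem by (auto simp: of_rat_divide of_rat_mult of_rat_minus)
  qed
  have mem2: "of_rat (s * (of_int L / (9 * of_int M))) \<in> ?B" if "s \<in> {1, -1}" for s
  proof -
    have "of_int L / of_int (9 * M) \<in> ?B" using p9 by (intro int_frac)
    then show ?thesis using that B.uminus_mem by (auto simp: of_rat_divide of_rat_mult of_rat_minus)
  qed
  show ?thesis
    unfolding S1_def [symmetric] S2_def [symmetric] m_def [symmetric]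
  proof (intro conjI impI ballI)
    assume "[p ^ m = 1] (mod q)"
    then have chi: "chi (int p) = 1" by (rule chi1)
    have zero: "of_rat 0 \<in> ?B" using B.zero_mem by simp
    show "rat_cong S1 0 (int p)"
      by (rule fin[OF S1_mem zero]) (use sum1(1)[OF chi] in \<open>simp only: of_rat_0\<close>)
    show "rat_cong S2 0 (int p)"
      by (rule fin[OF S2_mem zero]) (use sum2(1)[OF chi] in \<open>simp only: of_rat_0\<close>)
  next
    fix s :: rat assume s: "s \<in> {1, -1}"
    assume h: "rat_cong (of_nat (p ^ m)) ((-1 + s * (9 * of_int M / of_int L)) / 2) (int q)"
    define t :: int where "t = (if s = 1 then 1 else - 1)"
    have t: "s = of_int t" "t = 1 \<or> t = - 1" using s by (auto simp: t_def)
    have dvd: "int q dvd 2 * L * int (p ^ m) - (t * (9 * M) - L)"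
      using h by (rule rat_cong_imp_dvd[where v = "2 * L"]) (use LM0 t in \<open>simp add: field_simps\<close>)
    have "B.pcong p (of_rat S1) (of_rat (s * (3 * of_int M / of_int L)))"
      using t(2)
    proof
      assume "t = 1"
      then show ?thesis using sum1(2) chi2 dvd t(1) by simp
    next
      assume "t = - 1"
      then show ?thesis using sum1(3) chi3 dvd t(1) by (simp add: of_rat_minus)
    qed
    then show "rat_cong S1 (s * (3 * of_int M / of_int L)) (int p)"
      by (rule fin[OF S1_mem mem1[OF s]])
  next
    fix s :: rat assume s: "s \<in> {1, -1}"
    assume h: "rat_cong (of_nat (p ^ m)) ((-1 + s * (of_int L / (3 * of_int M))) / 2) (int q)"
    define t :: int where "t = (if s = 1 then 1 else - 1)"
    have t: "s = of_int t" "t = 1 \<or> t = - 1" using s by (auto simp: t_def)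
    have "int q dvd 6 * M * int (p ^ m) - (t * L - 3 * M)"
      using h by (rule rat_cong_imp_dvd[where v = "6 * M"]) (use LM0 t in \<open>simp add: field_simps\<close>)
    \<comment> \<open>Modulo \<open>q\<close> one has \<open>L / (3 M) = - 9 M / L\<close>.
      Multiplying by \<open>L\<close> and correcting by \<open>4 t q\<close> turns this hypothesis
      into that of the first sum with the opposite sign.\<close>
    then have "int q dvd L * (6 * M * int (p ^ m) - (t * L - 3 * M)) + t * (int q * 4)"
      by (rule dvd_add[OF dvd_mult dvd_mult]) simp
    also have "L * (6 * M * int (p ^ m) - (t * L - 3 * M)) + t * (int q * 4) =
        3 * M * (2 * L * int (p ^ m) - (- t * (9 * M) - L)) + t * (4 * int q - (L\<^sup>2 + 27 * M\<^sup>2))"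
      by (simp add: algebra_simps power2_eq_square)
    also have "\<dots> = 3 * M * (2 * L * int (p ^ m) - (- t * (9 * M) - L))" unfolding LM by simp
    finally have dvd: "int q dvd 2 * L * int (p ^ m) - (- t * (9 * M) - L)"
      using qM prime_iq by (metis prime_dvd_mult_iff)
    have "B.pcong p (of_rat S2) (of_rat (s * (of_int L / (9 * of_int M))))"
      using t(2)
    proof
      assume "t = 1"
      then show ?thesis using sum2(3) chi3 dvd t(1) by simp
    next
      assume "t = - 1"
      then show ?thesis using sum2(2) chi2 dvd t(1) by (simp add: of_rat_minus)
    qed
    then show "rat_cong S2 (s * (of_int L / (9 * of_int M))) (int p)"
      by (rule fin[OF S2_mem mem2[OF s]])
  qed
qed

end
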